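(* Let $1\le p<\infty$. There exist two frequently hypercyclic weighted shifts $B_v$ and $B_w$ on $\ell^p(\mathbb{N})$ such that $B_v$ and $B_w$ are disjoint upper frequently hypercyclic but not disjoint frequently hypercyclic.
   Context: $\mathbb{N}=\{1,2,\dots\}$; $\ell^p(\mathbb{N})$ is over $\mathbb{K}=\mathbb{R}$ or $\mathbb{C}$ with canonical basis $(e_n)_{n\ge1}$. For a bounded weight sequence $w=(w_n)_{n\ge1}$ of scalars, the unilateral weighted (backward) shift is $B_w(e_1)=0$, $B_w(e_n)=w_ne_{n-1}$ for $n\ge2$. For $A\subset\mathbb{N}$: $\underline{\mathrm{dens}}\,A=\liminf_{M\to\infty}\frac{\mathrm{card}\{n\le M:n\in A\}}{M}$, $\overline{\mathrm{dens}}\,A=\limsup_{M\to\infty}\frac{\mathrm{card}\{n\le M:n\in A\}}{M}$. An operator $T$ on $X$ is frequently hypercyclic if there is $x\in X$ such that $\underline{\mathrm{dens}}\{n:T^nx\in U\}>0$ for every non-empty open $U\subset X$. Operators $T_1,T_2$ on $X$ are disjoint frequently hypercyclic (resp. disjoint upper frequently hypercyclic) if there is $x\in X$ such that for all non-empty open $V_1,V_2\subset X$ the set $\{n:T_1^nx\in V_1\text{ and }T_2^nx\in V_2\}$ has positive lower density (resp. positive upper density). *)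

theory Defs
  imports "HOL-Analysis.Analysis"
begin

section \<open>The space of p-summable sequences\<close>

text \<open>
  The index set of the sequences, of the weights and of the times is {1, 2, ...}. A sequence
  indexed by it is a function on \<open>nat\<close> whose junk value at 0 is 0.
\<close>

definition lp :: "real \<Rightarrow> (nat \<Rightarrow> 'a::real_normed_field) set" where
  "lp p = {x. x 0 = 0 \<and> summable (\<lambda>n. norm (x n) powr p)}"

definition lp_norm :: "real \<Rightarrow> (nat \<Rightarrow> 'a::real_normed_field) \<Rightarrow> real" where
  "lp_norm p x = (\<Sum>n. norm (x n) powr p) powr (1 / p)"

definition lp_dist :: "real \<Rightarrow> (nat \<Rightarrow> 'a::real_normed_field) \<Rightarrow> (nat \<Rightarrow> 'a) \<Rightarrow> real" where
  "lp_dist p x y = lp_norm p (\<lambda>n. x n - y n)"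

text \<open>\<open>Metric_space_lp\<close> below shows that this is the topology of a metric on \<open>lp p\<close> when \<open>p \<ge> 1\<close>.\<close>

definition lp_topology :: "real \<Rightarrow> (nat \<Rightarrow> 'a::real_normed_field) topology" where
  "lp_topology p = Metric_space.mtopology (lp p) (lp_dist p)"

definition lp_basis :: "nat \<Rightarrow> nat \<Rightarrow> 'a::real_normed_field" where
  "lp_basis n = (\<lambda>k. if k = n then 1 else 0)"

section \<open>Weighted shifts\<close>

text \<open>
  The coordinate form of the operator with \<open>B e\<^sub>1 = 0\<close> and \<open>B e\<^sub>n = w\<^sub>n e\<^sub>n\<^sub>-\<^sub>1\<close> for \<open>n \<ge> 2\<close>;
  the values \<open>w 0\<close> and \<open>w 1\<close> are irrelevant.
\<close>

definition weighted_shift :: "(nat \<Rightarrow> 'a::real_normed_field) \<Rightarrow> (nat \<Rightarrow> 'a) \<Rightarrow> nat \<Rightarrow> 'a" where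
  "weighted_shift w x = (\<lambda>n. if n = 0 then 0 else w (n + 1) * x (n + 1))"

definition bounded_weights :: "(nat \<Rightarrow> 'a::real_normed_field) \<Rightarrow> bool" where
  "bounded_weights w \<longleftrightarrow> bounded (w ` {1..})"

section \<open>Densities\<close>

definition lower_density :: "nat set \<Rightarrow> ereal" where
  "lower_density A = liminf (\<lambda>M. ereal (real (card {n \<in> A. 1 \<le> n \<and> n \<le> M}) / real M))"

definition upper_density :: "nat set \<Rightarrow> ereal" where
  "upper_density A = limsup (\<lambda>M. ereal (real (card {n \<in> A. 1 \<le> n \<and> n \<le> M}) / real M))"

section \<open>Frequent hypercyclicity\<close>

definition frequently_hypercyclic :: "'b topology \<Rightarrow> ('b \<Rightarrow> 'b) \<Rightarrow> bool" where
  "frequently_hypercyclic X T \<longleftrightarrow>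
    (\<exists>x \<in> topspace X. \<forall>U. openin X U \<and> U \<noteq> {} \<longrightarrow>
      lower_density {n. (T ^^ n) x \<in> U} > 0)"

definition disjoint_frequently_hypercyclic ::
    "'b topology \<Rightarrow> ('b \<Rightarrow> 'b) \<Rightarrow> ('b \<Rightarrow> 'b) \<Rightarrow> bool" where
  "disjoint_frequently_hypercyclic X T\<^sub>1 T\<^sub>2 \<longleftrightarrow>
    (\<exists>x \<in> topspace X. \<forall>V\<^sub>1 V\<^sub>2. openin X V\<^sub>1 \<and> V\<^sub>1 \<noteq> {} \<and> openin X V\<^sub>2 \<and> V\<^sub>2 \<noteq> {} \<longrightarrow>
      lower_density {n. (T\<^sub>1 ^^ n) x \<in> V\<^sub>1 \<and> (T\<^sub>2 ^^ n) x \<in> V\<^sub>2} > 0)"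

definition disjoint_upper_frequently_hypercyclic ::
    "'b topology \<Rightarrow> ('b \<Rightarrow> 'b) \<Rightarrow> ('b \<Rightarrow> 'b) \<Rightarrow> bool" where
  "disjoint_upper_frequently_hypercyclic X T\<^sub>1 T\<^sub>2 \<longleftrightarrow>
    (\<exists>x \<in> topspace X. \<forall>V\<^sub>1 V\<^sub>2. openin X V\<^sub>1 \<and> V\<^sub>1 \<noteq> {} \<and> openin X V\<^sub>2 \<and> V\<^sub>2 \<noteq> {} \<longrightarrow>
      upper_density {n. (T\<^sub>1 ^^ n) x \<in> V\<^sub>1 \<and> (T\<^sub>2 ^^ n) x \<in> V\<^sub>2} > 0)"

section \<open>Well-definedness\<close>

lemma powr_convex_combination:
  fixes u s t p :: real
  assumes p: "p \<ge> 1" and u: "0 \<le> u" "u \<le> 1" and st: "s \<ge> 0" "t \<ge> 0"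
  shows "(u * s + (1 - u) * t) powr p \<le> u * s powr p + (1 - u) * t powr p"
proof -
  have scale: "(v * r) powr p \<le> v * r powr p" if "0 \<le> v" "v \<le> 1" "r \<ge> 0" for v r :: real
  proof -
    have "v powr p \<le> v"
    proof (cases "v = 0")
      case False
      then have "v powr p \<le> v powr 1"
        using that p by (intro powr_mono') auto
      then show ?thesis using that False by simp
    qed (use p in simp)
    then show ?thesis
      using that by (simp add: powr_mult mult_right_mono)
  qed
  consider "s = 0" | "t = 0" | "s > 0" "t > 0" using st by linarith
  then show ?thesis
  proof cases
    case 1
    then show ?thesis using scale[of "1 - u" t] u st p by simp
  next
    case 2
    then show ?thesis using scale[of u s] u st p by simp
  next
    case 3
    then show ?thesis
      using convex_onD[OF powr_convex[OF p], of "1 - u" s t] u by (simp add: algebra_simps)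
  qed
qed

lemma minkowski_bound:
  fixes x y :: "nat \<Rightarrow> 'a::real_normed_field"
  assumes p: "p \<ge> 1" and ab: "a > 0" "b > 0"
    and x: "summable (\<lambda>n. norm (x n) powr p)" "(\<Sum>n. norm (x n) powr p) \<le> a powr p"
    and y: "summable (\<lambda>n. norm (y n) powr p)" "(\<Sum>n. norm (y n) powr p) \<le> b powr p"
  shows "summable (\<lambda>n. norm (x n + y n) powr p)"
    and "(\<Sum>n. norm (x n + y n) powr p) \<le> (a + b) powr p"
proof -
  define u where "u = a / (a + b)"
  have u: "0 \<le> u" "u \<le> 1" "1 - u = b / (a + b)"
    using ab by (auto simp: u_def field_simps)
  let ?g = "\<lambda>n. (a + b) powr p *
    (u / a powr p * norm (x n) powr p + (1 - u) / b powr p * norm (y n) powr p)"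
  have le: "norm (x n + y n) powr p \<le> ?g n" for n
  proof -
    have "norm (x n + y n) powr p \<le> (norm (x n) + norm (y n)) powr p"
      using p by (intro powr_mono2) (auto simp: norm_triangle_ineq)
    also have "norm (x n) + norm (y n)
        = (a + b) * (u * (norm (x n) / a) + (1 - u) * (norm (y n) / b))"
    proof -
      have "u * (norm (x n) / a) = norm (x n) / (a + b)"
        "(1 - u) * (norm (y n) / b) = norm (y n) / (a + b)"
        unfolding u(3) unfolding u_def using ab by simp_all
      then show ?thesis
        using ab by (simp add: add_divide_distrib[symmetric])
    qed
    also have "\<dots> powr p
        = (a + b) powr p * (u * (norm (x n) / a) + (1 - u) * (norm (y n) / b)) powr p"
      by (rule powr_mult)
    also have "\<dots> \<le> (a + b) powr p *
        (u * (norm (x n) / a) powr p + (1 - u) * (norm (y n) / b) powr p)"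
      using ab u p by (intro mult_left_mono powr_convex_combination) auto
    also have "\<dots> = ?g n"
      using ab by (simp add: powr_divide)
    finally show ?thesis .
  qed
  have g: "summable ?g"
    by (intro summable_mult summable_add x(1) y(1))
  show s: "summable (\<lambda>n. norm (x n + y n) powr p)"
    by (rule summable_comparison_test'[OF g, of 0]) (use le in auto)
  have "(\<Sum>n. norm (x n + y n) powr p) \<le> (\<Sum>n. ?g n)"
    by (intro suminf_le le s g)
  also have "\<dots> = (a + b) powr p * (u / a powr p * (\<Sum>n. norm (x n) powr p)
      + (1 - u) / b powr p * (\<Sum>n. norm (y n) powr p))"
    using x(1) y(1) by (intro sums_unique[symmetric] sums_mult sums_add summable_sums)
  also have "\<dots> \<le> (a + b) powr p * (u / a powr p * a powr p + (1 - u) / b powr p * b powr p)"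
    using u(1,2) x(2) y(2) by (intro mult_left_mono add_mono) auto
  also have "\<dots> = (a + b) powr p" using ab by simp
  finally show "(\<Sum>n. norm (x n + y n) powr p) \<le> (a + b) powr p" .
qed

lemma lp_norm_nonneg: "lp_norm p x \<ge> 0"
  by (simp add: lp_norm_def)

lemma lp_norm_powr:
  assumes "p \<ge> 1" "x \<in> lp p"
  shows "lp_norm p x powr p = (\<Sum>n. norm (x n) powr p)"
  using assms by (simp add: lp_norm_def lp_def powr_powr suminf_nonneg)

lemma lp_norm_le:
  assumes "p \<ge> 1" "x \<in> lp p" "a \<ge> 0" "(\<Sum>n. norm (x n) powr p) \<le> a powr p"
  shows "lp_norm p x \<le> a"
proof -
  have "lp_norm p x \<le> (a powr p) powr (1 / p)"
    unfolding lp_norm_def using assms by (intro powr_mono2) (auto simp: lp_def suminf_nonneg)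
  then show ?thesis using assms by (simp add: powr_powr)
qed

lemma lp_norm_eq_0:
  assumes "p \<ge> 1" "x \<in> lp p"
  shows "lp_norm p x = 0 \<longleftrightarrow> x = (\<lambda>n. 0)"
  using assms suminf_eq_zero_iff[of "\<lambda>n. norm (x n) powr p"]
  by (auto simp: lp_norm_def lp_def fun_eq_iff)

lemma lp_add_norm:
  assumes p: "p \<ge> 1" and x: "x \<in> lp p" and y: "y \<in> lp p"
  shows "(\<lambda>n. x n + y n) \<in> lp p" "lp_norm p (\<lambda>n. x n + y n) \<le> lp_norm p x + lp_norm p y"
proof -
  let ?s = "\<lambda>n. x n + y n"
  have bound: "(\<Sum>n. norm (z n) powr p) \<le> (lp_norm p z + e) powr p"
    if "z \<in> lp p" "e > 0" for z :: "nat \<Rightarrow> 'a" and e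
    using lp_norm_powr[OF p that(1)] powr_mono2[of p "lp_norm p z" "lp_norm p z + e"]
      that p lp_norm_nonneg[of p z] by simp
  have pos: "lp_norm p z + e > 0" if "e > 0" for z :: "nat \<Rightarrow> 'a" and e
    using that lp_norm_nonneg[of p z] by simp
  have sums: "summable (\<lambda>n. norm (x n) powr p)" "summable (\<lambda>n. norm (y n) powr p)"
    using x y by (auto simp: lp_def)
  note M = minkowski_bound[OF p pos pos sums(1) bound[OF x] sums(2) bound[OF y]]
  show s: "?s \<in> lp p"
    using M(1)[of 1 1] x y by (simp add: lp_def)
  show "lp_norm p ?s \<le> lp_norm p x + lp_norm p y"
  proof (rule field_le_epsilon)
    fix e :: real assume e: "e > 0"
    have "lp_norm p ?s \<le> (lp_norm p x + e / 2) + (lp_norm p y + e / 2)"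
      using e pos[of "e / 2" x] pos[of "e / 2" y]
      by (intro lp_norm_le[OF p s] M(2)) auto
    then show "lp_norm p ?s \<le> lp_norm p x + lp_norm p y + e" by simp
  qed
qed

lemma lp_diff:
  assumes "p \<ge> 1" "x \<in> lp p" "y \<in> lp p"
  shows "(\<lambda>n. x n - y n) \<in> lp p"
  using lp_add_norm(1)[OF assms(1,2), of "\<lambda>n. - y n"] assms(3) by (simp add: lp_def)

lemma Metric_space_lp:
  assumes p: "p \<ge> 1"
  shows "Metric_space (lp p) (lp_dist p :: (nat \<Rightarrow> 'a::real_normed_field) \<Rightarrow> _)"
proof
  fix x y z :: "nat \<Rightarrow> 'a"
  show "0 \<le> lp_dist p x y" by (simp add: lp_dist_def lp_norm_nonneg)
  show "lp_dist p x y = lp_dist p y x"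
    by (simp add: lp_dist_def lp_norm_def norm_minus_commute)
  assume x: "x \<in> lp p" and y: "y \<in> lp p"
  show "lp_dist p x y = 0 \<longleftrightarrow> x = y"
    using lp_norm_eq_0[OF p lp_diff[OF p x y]] by (auto simp: lp_dist_def fun_eq_iff)
  assume z: "z \<in> lp p"
  show "lp_dist p x z \<le> lp_dist p x y + lp_dist p y z"
    using lp_add_norm(2)[OF p lp_diff[OF p x y] lp_diff[OF p y z]] by (simp add: lp_dist_def)
qed

lemma topspace_lp_topology: "p \<ge> 1 \<Longrightarrow> topspace (lp_topology p) = lp p"
  unfolding lp_topology_def
  by (rule Metric_space.topspace_mtopology[OF Metric_space_lp])

lemma weighted_shift_basis:
  "weighted_shift w (lp_basis 1) = (\<lambda>k. 0)"
  "n \<ge> 2 \<Longrightarrow> weighted_shift w (lp_basis n) = (\<lambda>k. w n * lp_basis (n - 1) k)"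
  by (auto simp: weighted_shift_def lp_basis_def fun_eq_iff)

lemma weighted_shift_linear:
  "weighted_shift w (\<lambda>n. c * x n + d * y n)
    = (\<lambda>n. c * weighted_shift w x n + d * weighted_shift w y n)"
  by (auto simp: weighted_shift_def algebra_simps)

lemma weighted_shift_bounded_operator:
  assumes p: "p \<ge> 1" and w: "bounded_weights w"
  shows "\<exists>C\<ge>0. \<forall>x \<in> lp p. weighted_shift w x \<in> lp p
           \<and> lp_norm p (weighted_shift w x) \<le> C * lp_norm p x"
proof -
  obtain C where C: "C > 0" "\<And>n. n \<ge> 1 \<Longrightarrow> norm (w n) \<le> C"
    using w unfolding bounded_weights_def bounded_pos by auto
  have "weighted_shift w x \<in> lp p \<and> lp_norm p (weighted_shift w x) \<le> C * lp_norm p x"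
    if x: "x \<in> lp p" for x
  proof -
    let ?f = "\<lambda>n. norm (x n) powr p"
    have f: "summable ?f" using x by (simp add: lp_def)
    have g: "summable (\<lambda>n. C powr p * ?f (Suc n))"
      using f by (intro summable_mult) (subst summable_Suc_iff)
    have le: "norm (weighted_shift w x n) powr p \<le> C powr p * ?f (Suc n)" for n
    proof (cases "n = 0")
      case False
      then have "norm (weighted_shift w x n) powr p \<le> (C * norm (x (Suc n))) powr p"
        using p C by (intro powr_mono2) (auto simp: weighted_shift_def norm_mult mult_right_mono)
      then show ?thesis using C by (simp add: powr_mult)
    qed (use p in \<open>simp add: weighted_shift_def\<close>)
    have s: "summable (\<lambda>n. norm (weighted_shift w x n) powr p)"
      by (rule summable_comparison_test'[OF g, of 0]) (use le in auto)
    then have m: "weighted_shift w x \<in> lp p"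
      by (simp add: lp_def weighted_shift_def)
    have "(\<Sum>n. norm (weighted_shift w x n) powr p) \<le> (\<Sum>n. C powr p * ?f (Suc n))"
      by (intro suminf_le le s g)
    also have "\<dots> = C powr p * (\<Sum>n. ?f (Suc n))"
      using f by (intro suminf_mult) (subst summable_Suc_iff)
    also have "(\<Sum>n. ?f (Suc n)) = (\<Sum>n. ?f n)"
      using suminf_split_head[OF f] x p by (simp add: lp_def)
    also have "C powr p * (\<Sum>n. ?f n) = (C * lp_norm p x) powr p"
      using C lp_norm_powr[OF p x] lp_norm_nonneg[of p x] by (simp add: powr_mult)
    finally show ?thesis
      using m C lp_norm_nonneg[of p x] by (auto intro!: lp_norm_le[OF p m])
  qed
  then show ?thesis using C(1) by (intro exI[of _ C]) auto
qed

end

theory Submission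
  imports Defs
begin

text \<open>
  Write \<open>V\<^sub>l = v\<^sub>1 \<cdots> v\<^sub>l\<close> and \<open>W\<^sub>l = w\<^sub>1 \<cdots> w\<^sub>l\<close>. At coordinate \<open>k\<close>, the \<open>n\<close>-th iterates of the two
  shifts at \<open>x\<close> are \<open>V\<^sub>n\<^sub>+\<^sub>k x\<^sub>n\<^sub>+\<^sub>k / V\<^sub>k\<close> and \<open>W\<^sub>n\<^sub>+\<^sub>k x\<^sub>n\<^sub>+\<^sub>k / W\<^sub>k\<close>: both read the same entry of \<open>x\<close>, so
  the quotient of what they show is prescribed by the ratio \<open>W\<^sub>l / V\<^sub>l\<close> near \<open>l = n\<close>. If both
  \<open>|V\<^sub>l|\<close> and \<open>|W\<^sub>l|\<close> grow geometrically, each shift on its own is frequently hypercyclic, since one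
  may simply write the desired images, divided by \<open>V\<^sub>l\<close>, into a vector \<open>x\<close> at well separated
  times. The two shifts can follow independent targets at the same times only where the ratio is
  shaped accordingly, and the sequence of ratios is ours to choose.
  
  A \<^emph>\<open>pattern\<close> is a finite list of pairs of non-zero scalars; countably many patterns approximate all
  pairs of targets. Pattern number \<open>j\<close> is attached to the times \<open>pos q\<close> with \<open>ruler q = j\<close>, where
  \<open>ruler\<close> is the ruler sequence. These times have positive lower density
  (\<open>lower_density_class\<close>), and yet \<open>pos q\<close> is at distance more than \<open>ruler q + ruler r\<close> from every
  other \<open>pos r\<close> (\<open>pos_gap\<close>). Around \<open>pos q\<close> there is thus room for pattern \<open>ruler q\<close>, and the
  geometric growth makes everything written later invisible at time \<open>pos q\<close>, up to an error
  \<open>2\<^bsup>-ruler q\<^esup>\<close> (\<open>hitting_vector_orbit\<close>).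
  
  The ratio \<open>W\<^sub>l / V\<^sub>l\<close> spells the pattern of \<open>q\<close> just after \<open>pos q\<close> if \<open>q\<close> is \<open>good\<close>, and it is 1
  everywhere else. A jump of the ratio by a large factor would need a large weight; instead both
  products lose that factor for ever and the weights stay bounded. A cheapness condition on the
  patterns ensures that the total loss up to \<open>l\<close> is at most \<open>2\<^sup>l\<close> (\<open>budget_le\<close>), which the factor
  \<open>8\<^sup>l\<close> in front outweighs.
  
  The good indices are those in \<open>[i!, (i+1)!)\<close> with \<open>i\<close> even. Each such block is much longer than
  all that precedes it. Hence the good times of each pattern have positive upper density, so the
  shifts are disjoint upper frequently hypercyclic; but up to the end of a block with \<open>i\<close> odd
  nearly all times have ratio 1. At those times both iterates have the same first coordinate, so
  they are not near 0 and near 1 respectively, and no vector is disjoint frequently hypercyclic.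
\<close>

section \<open>The ruler sequence and separated times\<close>

text \<open>
  The number of trailing ones in the binary expansion of \<open>n\<close>, that is, the exponent of 2 in
  \<open>n + 1\<close>.
\<close>

function ruler :: "nat \<Rightarrow> nat" where
  "ruler n = (if even n then 0 else Suc (ruler (n div 2)))"
  by auto
termination by (relation less_than) (auto elim: oddE)

declare ruler.simps [simp del]

lemma ruler_even: "even n \<Longrightarrow> ruler n = 0"
  by (subst ruler.simps) simp

lemma ruler_double_Suc: "ruler (Suc (2 * n)) = Suc (ruler n)"
  by (subst ruler.simps) simp

lemma ruler_class: "ruler (2 ^ j * (2 * t + 1) - 1) = j"
proof (induction j)
  case 0
  show ?case by (simp add: ruler_even)
next
  case (Suc j)
  have "(2::nat) ^ j * (2 * t + 1) \<noteq> 0" by simp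
  then have "2 ^ Suc j * (2 * t + 1) - 1 = Suc (2 * (2 ^ j * (2 * t + 1) - 1))"
    unfolding power_Suc mult.assoc by linarith
  then show ?case using Suc ruler_double_Suc by simp
qed

text \<open>
  The value at least \<open>j\<close> is taken with frequency \<open>2\<^bsup>-j\<^esup>\<close>, so the mean of the sequence is at most 1.
  This is what allows gaps as long as the values of \<open>ruler\<close> at a linear cost, see \<open>pos_le\<close>.
\<close>

lemma sum_ruler_le: "(\<Sum>i<n. ruler i) \<le> n"
proof (induction n rule: less_induct)
  case (less n)
  have double: "(\<Sum>i<2 * m. ruler i) = m + (\<Sum>i<m. ruler i)" for m
    by (induction m) (auto simp: ruler_even ruler_double_Suc)
  show ?case
  proof (cases "even n")
    case True
    then obtain m where m: "n = 2 * m" by blast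
    show ?thesis
      using less[of m] double[of m] m by (cases "m = 0") auto
  next
    case False
    then obtain m where m: "n = Suc (2 * m)" using oddE by fastforce
    show ?thesis
      using less[of m] double[of m] m by (auto simp: ruler_even)
  qed
qed

text \<open>
  Consecutive times are separated by the sum of their classes, so that each time has a gap as long
  as its class on both sides.
\<close>

definition pos :: "nat \<Rightarrow> nat" where
  "pos q = (\<Sum>i<q. ruler i + ruler (Suc i) + 1)"

lemma pos_0: "pos 0 = 0" and pos_Suc: "pos (Suc q) = pos q + ruler q + ruler (Suc q) + 1"
  by (auto simp: pos_def)

lemma pos_gap: "q < r \<Longrightarrow> pos q + ruler q + ruler r < pos r"
proof (induction r)
  case (Suc r)
  then show ?case by (cases "q = r") (auto simp: pos_Suc)
qed simp

lemma strict_mono_pos: "strict_mono pos"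
  by (rule strict_monoI) (use pos_gap in fastforce)

lemma pos_eq_sums: "pos q = (\<Sum>i<q. ruler i) + (\<Sum>i<Suc q. ruler i) + q"
  by (induction q) (auto simp: pos_0 pos_Suc ruler_even)

lemma pos_ge: "q \<le> pos q" "(\<Sum>i<Suc q. ruler i) \<le> pos q" "ruler q \<le> pos q"
  by (auto simp: pos_eq_sums)

lemma pos_le: "pos q \<le> 3 * Suc q"
  using sum_ruler_le[of q] sum_ruler_le[of "Suc q"] unfolding pos_eq_sums by simp

text \<open>
  Every \<open>l\<close> is uniquely \<open>pos q + k\<close> with \<open>l < pos (Suc q)\<close>; \<open>blk\<close> and \<open>off\<close> recover \<open>q\<close> and \<open>k\<close>.
\<close>

definition blk :: "nat \<Rightarrow> nat" where
  "blk l = (LEAST q. l < pos (Suc q))"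

definition off :: "nat \<Rightarrow> nat" where
  "off l = l - pos (blk l)"

lemma less_pos_Suc_blk: "l < pos (Suc (blk l))"
  unfolding blk_def by (rule LeastI[of _ l]) (use pos_ge(1)[of "Suc l"] in simp)

lemma pos_blk_le: "pos (blk l) \<le> l"
proof (cases "blk l")
  case (Suc q)
  then have "\<not> l < pos (Suc q)"
    using not_less_Least[of q "\<lambda>q. l < pos (Suc q)"] by (simp add: blk_def)
  then show ?thesis using Suc by simp
qed (simp add: pos_0)

lemma blk_eqI:
  assumes "pos q \<le> l" "l < pos (Suc q)"
  shows "blk l = q" "off l = l - pos q"
proof -
  have "\<not> q < blk l" "\<not> blk l < q"
    using assms pos_blk_le[of l] less_pos_Suc_blk[of l]
      strict_mono_less_eq[OF strict_mono_pos, of "Suc q" "blk l"]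
      strict_mono_less_eq[OF strict_mono_pos, of "Suc (blk l)" q] by auto
  then show "blk l = q" by simp
  then show "off l = l - pos q" by (simp add: off_def)
qed

lemma blk_window: "k \<le> ruler q \<Longrightarrow> blk (pos q + k) = q" "k \<le> ruler q \<Longrightarrow> off (pos q + k) = k"
  using blk_eqI[of q "pos q + k"] by (auto simp: pos_Suc)

lemma blk_Suc:
  "blk (Suc l) = blk l \<and> off (Suc l) = Suc (off l) \<or> blk (Suc l) = Suc (blk l) \<and> off (Suc l) = 0"
proof (cases "Suc l < pos (Suc (blk l))")
  case True
  then show ?thesis
    using blk_eqI[of "blk l" "Suc l"] pos_blk_le[of l] by (auto simp: off_def)
next
  case False
  then have "Suc l = pos (Suc (blk l))" using less_pos_Suc_blk[of l] by simp
  then show ?thesis using blk_window[of 0 "Suc (blk l)"] by simp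
qed

text \<open>
  A coordinate outside the block of \<open>q\<close> is seen from time \<open>pos q\<close> at a distance that pays both for
  the precision wanted at \<open>q\<close> and for the size of the entries of the later block.
\<close>

lemma blk_gap:
  assumes "pos q \<le> l" "blk l \<noteq> q"
  shows "pos q + ruler q + ruler (blk l) < l"
proof -
  have "\<not> blk l < q"
    using assms(1) less_pos_Suc_blk[of l]
      strict_mono_less_eq[OF strict_mono_pos, of "Suc (blk l)" q] by auto
  then show ?thesis
    using assms(2) pos_gap[of q "blk l"] pos_blk_le[of l] by simp
qed

lemma blk_le: "blk l \<le> l"
  using pos_ge(1)[of "blk l"] pos_blk_le[of l] by simp

text \<open>
  The indices of class \<open>j\<close> are \<open>2\<^sup>j (2t + 1) - 1\<close>, and \<open>pos q \<le> 3 (q + 1)\<close> places at least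
  the integer part of \<open>M / (6 \<cdot> 2\<^sup>j)\<close> of the corresponding times below \<open>M\<close>. Indices below \<open>L\<close> are discarded, at a
  cost of at most \<open>L\<close>; discarding \<open>q = 0\<close> keeps the times positive.
\<close>

lemma card_class_ge:
  assumes "1 \<le> L"
  shows "M div (6 * 2 ^ j) - L
    \<le> card {n \<in> {pos q |q. ruler q = j \<and> L \<le> q \<and> q < M}. 1 \<le> n \<and> n \<le> M}" (is "_ \<le> card ?S")
proof -
  let ?q = "\<lambda>t::nat. 2 ^ j * (2 * t + 1) - 1 :: nat"
  have Suc_q: "Suc (?q t) = 2 ^ j * (2 * t + 1)" for t by simp
  have "(\<lambda>t. pos (?q t)) ` {L..<M div (6 * 2 ^ j)} \<subseteq> ?S"
  proof (intro image_subsetI CollectI conjI)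
    fix t assume t: "t \<in> {L..<M div (6 * 2 ^ j)}"
    have "3 * Suc (?q t) \<le> 6 * 2 ^ j * Suc t"
      unfolding Suc_q by (simp add: algebra_simps)
    also have "\<dots> \<le> 6 * 2 ^ j * (M div (6 * 2 ^ j))"
      using t by (intro mult_left_mono) auto
    also have "\<dots> \<le> M" by simp
    finally have M: "3 * Suc (?q t) \<le> M" .
    have "x < 3 * Suc x" for x :: nat by simp
    from less_le_trans[OF this M] have q: "?q t < M" .
    have "1 * (2 * t + 1) \<le> (2::nat) ^ j * (2 * t + 1)"
      by (intro mult_right_mono) auto
    then have "2 * t + 1 \<le> 2 ^ j * (2 * t + 1)" by (simp only: mult_1)
    then have "2 * t \<le> ?q t" by (rule add_le_imp_le_diff)
    moreover have "L \<le> 2 * t" using t by simp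
    ultimately have L: "L \<le> ?q t" by (rule order_trans[rotated])
    show "\<exists>q. pos (?q t) = pos q \<and> ruler q = j \<and> L \<le> q \<and> q < M"
      using L q by (intro exI[of _ "?q t"] conjI refl ruler_class)
    show "1 \<le> pos (?q t)" using assms L pos_ge(1) by (meson order_trans)
    show "pos (?q t) \<le> M" using pos_le M by (rule order_trans)
  qed
  moreover have "inj_on (\<lambda>t. pos (?q t)) {L..<M div (6 * 2 ^ j)}"
  proof (rule inj_onI)
    fix s t assume "pos (?q s) = pos (?q t)"
    then have "?q s = ?q t" using strict_mono_eq[OF strict_mono_pos] by blast
    then have "Suc (?q s) = Suc (?q t)" by simp
    then show "s = t" unfolding Suc_q by simp
  qed
  ultimately have "card {L..<M div (6 * 2 ^ j)} \<le> card ?S"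
    by (intro card_inj_on_le) auto
  then show ?thesis by simp
qed

section \<open>Densities of the separated times\<close>

lemma lower_density_posI:
  assumes "c > 0" "\<And>M. M \<ge> M0 \<Longrightarrow> c * real M \<le> card {n \<in> A. 1 \<le> n \<and> n \<le> M}" "A \<subseteq> B"
  shows "lower_density B > 0"
proof -
  have "ereal c \<le> lower_density B"
    unfolding lower_density_def
  proof (rule Liminf_bounded, rule eventually_sequentiallyI)
    fix M assume M: "Suc M0 \<le> M"
    have "c * real M \<le> card {n \<in> A. 1 \<le> n \<and> n \<le> M}" using assms(2) M by simp
    also have "\<dots> \<le> card {n \<in> B. 1 \<le> n \<and> n \<le> M}"
      using assms(3) by (intro of_nat_mono card_mono) auto
    finally show "ereal c \<le> ereal (card {n \<in> B. 1 \<le> n \<and> n \<le> M} / real M)"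
      using M by (simp add: field_simps)
  qed
  then show ?thesis using assms(1) by (metis ereal_less(2) less_le_trans)
qed

lemma upper_density_posI:
  assumes "c > 0" "\<And>M0. \<exists>M\<ge>M0. c * real M \<le> card {n \<in> A. 1 \<le> n \<and> n \<le> M}" "A \<subseteq> B"
  shows "upper_density B > 0"
proof (rule ccontr)
  assume "\<not> upper_density B > 0"
  then have "upper_density B < ereal c" using assms(1) by (metis ereal_less(2) not_less le_less_trans)
  then obtain M0 where M0:
    "\<And>M. M \<ge> M0 \<Longrightarrow> ereal (card {n \<in> B. 1 \<le> n \<and> n \<le> M} / real M) < ereal c"
    unfolding upper_density_def using Limsup_lessD eventually_sequentially by fastforce
  obtain M where M: "M \<ge> Suc M0" "c * real M \<le> card {n \<in> A. 1 \<le> n \<and> n \<le> M}"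
    using assms(2) by blast
  note M(2)
  also have "card {n \<in> A. 1 \<le> n \<and> n \<le> M} \<le> card {n \<in> B. 1 \<le> n \<and> n \<le> M}"
    using assms(3) by (intro card_mono) auto
  finally show False using M0[of M] M(1) by (simp add: field_simps)
qed

lemma lower_density_not_posI:
  assumes "\<And>c M0. c > 0 \<Longrightarrow> \<exists>M\<ge>M0. card {n \<in> A. 1 \<le> n \<and> n \<le> M} \<le> c * real M" "B \<subseteq> A"
  shows "\<not> lower_density B > 0"
proof
  assume "lower_density B > 0"
  then obtain c where c: "0 < ereal c" "ereal c < lower_density B"
    using ereal_dense2 by blast
  then obtain M0 where M0:
    "\<And>M. M \<ge> M0 \<Longrightarrow> ereal c < ereal (card {n \<in> B. 1 \<le> n \<and> n \<le> M} / real M)"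
    unfolding lower_density_def using less_LiminfD eventually_sequentially by fastforce
  obtain M where M: "M \<ge> Suc M0" "card {n \<in> A. 1 \<le> n \<and> n \<le> M} \<le> c * real M"
    using assms(1) c(1) by (metis ereal_less(2))
  have "real (card {n \<in> B. 1 \<le> n \<and> n \<le> M}) \<le> card {n \<in> A. 1 \<le> n \<and> n \<le> M}"
    using assms(2) by (intro of_nat_mono card_mono) auto
  also note M(2)
  finally show False using M0[of M] M(1) by (simp add: field_simps)
qed

lemma real_div_minus_one_le: "real m / real n - 1 \<le> real (m div n)"
proof -
  have "real_of_int \<lfloor>real m / real n\<rfloor> = real (m div n)"
    by (simp add: floor_divide_of_nat_eq)
  then show ?thesis by linarith
qed

text \<open>
  Factorials are used only because \<open>i! / (i+1)!\<close> tends to 0: each block dwarfs all earlier ones.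
\<close>

definition good :: "nat set" where
  "good = {q. \<exists>i. even i \<and> fact i \<le> q \<and> q < fact (Suc i)}"

lemma lower_density_class: "{pos q |q. ruler q = j} \<subseteq> B \<Longrightarrow> lower_density B > 0"
proof (rule lower_density_posI)
  let ?m = "6 * 2 ^ j :: nat"
  fix M :: nat assume M: "M \<ge> 4 * ?m"
  have "real M / ?m - 2 \<le> real (M div ?m) - 1"
    using real_div_minus_one_le[of M ?m] by linarith
  moreover have "1 / (2 * ?m) * real M \<le> real M / ?m - 2"
    using M by (simp add: field_simps flip: of_nat_le_iff[where 'a=real])
  moreover have "real (M div ?m) - 1 \<le> real (M div ?m - 1)" by linarith
  ultimately have "1 / (2 * ?m) * real M \<le> real (M div ?m - 1)" by linarith
  also have "\<dots> \<le> card {n \<in> {pos q |q. ruler q = j \<and> 1 \<le> q \<and> q < M}. 1 \<le> n \<and> n \<le> M}"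
    using card_class_ge[of 1 M j] by linarith
  also have "\<dots> \<le> card {n \<in> {pos q |q. ruler q = j}. 1 \<le> n \<and> n \<le> M}"
    by (intro of_nat_mono card_mono) auto
  finally show "1 / (2 * ?m) * real M \<le> card {n \<in> {pos q |q. ruler q = j}. 1 \<le> n \<and> n \<le> M}" .
qed auto

text \<open>
  Count up to the end \<open>M = (i+1)!\<close> of a good block: the times of class \<open>j\<close> make up at least
  \<open>M / (6 \<cdot> 2\<^sup>j) - 1\<close>, and removing those with indices before the block costs only \<open>i!\<close>, a small
  fraction of \<open>M\<close> for large \<open>i\<close>.
\<close>

lemma upper_density_good_class: "{pos q |q. ruler q = j \<and> q \<in> good} \<subseteq> B \<Longrightarrow> upper_density B > 0"
proof (rule upper_density_posI)
  let ?m = "6 * 2 ^ j :: nat" and ?A = "{pos q |q. ruler q = j \<and> q \<in> good}"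
  fix M0 :: nat
  define i where "i = 2 * (M0 + 4 * ?m)"
  define M :: nat where "M = fact (Suc i)"
  have i: "even i" "4 * ?m \<le> Suc i" by (auto simp: i_def)
  have f: "M = Suc i * fact i" "1 \<le> (fact i :: nat)" by (auto simp: M_def)
  have Mi: "Suc i \<le> M" unfolding M_def by (rule fact_ge_self)
  have 1: "real M / ?m - 1 \<le> real (M div ?m)"
    using real_div_minus_one_le[of M ?m] by linarith
  have "4 * ?m * fact i \<le> M" unfolding f(1) using i(2) by (rule mult_right_mono) simp
  then have "real (4 * ?m * fact i) \<le> real M" by (simp only: of_nat_le_iff)
  then have 2: "fact i \<le> real M / (4 * ?m)" by (simp add: field_simps)
  have "4 * ?m \<le> M" using i(2) Mi by linarith
  then have "real (4 * ?m) \<le> real M" by (simp only: of_nat_le_iff)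
  then have 3: "1 \<le> real M / (4 * ?m)" by (simp add: field_simps)
  have "1 / (2 * ?m) * real M = real M / ?m - real M / (4 * ?m) - real M / (4 * ?m)"
    by (simp add: field_simps)
  also have "\<dots> \<le> real (M div ?m) - fact i" using 1 2 3 by linarith
  also have "\<dots> \<le> real (M div ?m - fact i)"
    using of_nat_fact[of i, where 'a=real] by linarith
  also have "\<dots> \<le> card {n \<in> {pos q |q. ruler q = j \<and> fact i \<le> q \<and> q < M}. 1 \<le> n \<and> n \<le> M}"
    using card_class_ge[OF f(2), of M j] by linarith
  also have "\<dots> \<le> card {n \<in> ?A. 1 \<le> n \<and> n \<le> M}"
    by (intro of_nat_mono card_mono) (use i(1) in \<open>auto simp: good_def M_def\<close>)
  finally show "\<exists>M\<ge>M0. 1 / (2 * ?m) * real M \<le> card {n \<in> ?A. 1 \<le> n \<and> n \<le> M}"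
    using Mi by (intro exI[of _ M] conjI) (auto simp: i_def)
qed auto

lemma good_less_fact:
  assumes "q \<in> good" "odd i" "q < fact (Suc i)"
  shows "q < fact i"
proof (rule ccontr)
  assume n: "\<not> q < fact i"
  obtain k where k: "even k" "fact k \<le> q" "q < fact (Suc k)"
    using assms(1) by (auto simp: good_def)
  have "\<not> Suc i \<le> k" using k(2) assms(3) fact_mono_nat[of "Suc i" k] by linarith
  moreover have "\<not> Suc k \<le> i" using k(3) n fact_mono_nat[of "Suc k" i] by linarith
  ultimately show False using k(1) assms(2) by (metis le_antisym not_less_eq_eq)
qed

text \<open>
  Count up to the end of a block with \<open>i\<close> odd: all good indices met so far lie below \<open>i!\<close>, and they account
  for times up to \<open>pos (i!) \<le> 6 i!\<close> only.
\<close>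

lemma lower_density_good:
  assumes "B \<subseteq> {n. blk (Suc n) \<in> good}"
  shows "\<not> lower_density B > 0"
proof (rule lower_density_not_posI[OF _ assms])
  fix c :: real and M0 :: nat assume c: "c > 0"
  obtain i0 :: nat where i0: "12 / c < i0" using reals_Archimedean2 by blast
  define i where "i = Suc (2 * (M0 + i0 + 1))"
  define M :: nat where "M = fact (Suc i) - 2"
  have i: "odd i" by (simp add: i_def)
  have "4 \<le> Suc i" by (simp add: i_def)
  also have "Suc i \<le> fact (Suc i)" by (rule fact_ge_self)
  finally have M4: "4 \<le> (fact (Suc i) :: nat)" .
  from M4 have M2: "fact (Suc i) \<le> 2 * M" by (simp add: M_def)
  have "{n \<in> {n. blk (Suc n) \<in> good}. 1 \<le> n \<and> n \<le> M} \<subseteq> {1..6 * fact i}"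
  proof
    fix n assume n: "n \<in> {n \<in> {n. blk (Suc n) \<in> good}. 1 \<le> n \<and> n \<le> M}"
    have "Suc n < fact (Suc i)" using n M4 by (auto simp: M_def)
    then have "blk (Suc n) < fact (Suc i)" using blk_le[of "Suc n"] by linarith
    then have b: "blk (Suc n) < fact i" using n i good_less_fact by blast
    have "Suc n < pos (Suc (blk (Suc n)))" by (rule less_pos_Suc_blk)
    also have "\<dots> \<le> pos (fact i)" using b strict_mono_less_eq[OF strict_mono_pos] by simp
    also have "\<dots> \<le> 3 * Suc (fact i)" by (rule pos_le)
    also have "\<dots> \<le> 6 * fact i"
    proof -
      have "3 * Suc x \<le> 6 * x" if "1 \<le> x" for x :: nat using that by simp
      from this[OF fact_ge_1] show ?thesis .
    qed
    finally have "Suc n < 6 * fact i" .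
    moreover have "1 \<le> n" using n by blast
    ultimately show "n \<in> {1..6 * fact i}" by (meson Suc_lessD atLeastAtMost_iff less_imp_le)
  qed
  from card_mono[OF _ this]
  have "card {n \<in> {n. blk (Suc n) \<in> good}. 1 \<le> n \<and> n \<le> M} \<le> 6 * fact i"
    by (simp only: finite_atLeastAtMost card_atLeastAtMost add_diff_cancel_right' Suc_eq_plus1)
  then have "real (card {n \<in> {n. blk (Suc n) \<in> good}. 1 \<le> n \<and> n \<le> M}) \<le> real (6 * fact i)"
    by (simp only: of_nat_le_iff)
  also have "real (6 * fact i) \<le> c * (Suc i * fact i / 2)"
  proof -
    have "12 < c * real i0" using i0 c by (simp add: field_simps)
    also have "\<dots> \<le> c * real (Suc i)" using c by (simp add: i_def)
    finally have "12 < c * real (Suc i)" .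
    moreover have "6 * x \<le> c * (y * x / 2)" if "12 < c * y" "x \<ge> 0" for x y :: real
      using mult_right_mono[of 12 "c * y" x] that by simp
    ultimately have "6 * fact i \<le> c * (real (Suc i) * fact i / 2)" using fact_ge_zero by blast
    then show ?thesis by (simp only: of_nat_mult of_nat_numeral of_nat_fact)
  qed
  also have "\<dots> \<le> c * M"
  proof -
    have "real (fact (Suc i)) \<le> real (2 * M)" using M2 by (simp only: of_nat_le_iff)
    then show ?thesis using c by (intro mult_left_mono) auto
  qed
  finally have "real (card {n \<in> {n. blk (Suc n) \<in> good}. 1 \<le> n \<and> n \<le> M}) \<le> c * M" .
  moreover have "M0 \<le> M"
  proof -
    have "M0 + 2 \<le> Suc i" by (simp add: i_def)
    also have "Suc i \<le> fact (Suc i)" by (rule fact_ge_self)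
    finally show ?thesis by (simp only: M_def add_le_imp_le_diff)
  qed
  ultimately show "\<exists>M\<ge>M0. card {n \<in> {n. blk (Suc n) \<in> good}. 1 \<le> n \<and> n \<le> M} \<le> c * real M"
    by blast
qed

section \<open>Open sets of p-summable sequences\<close>

text \<open>
  Pointwise geometric bounds replace all norm estimates on orbits; the constant 2 is uniform in \<open>p\<close>
  because \<open>(2\<^bsup>-l\<^esup>)\<^sup>p \<le> 2\<^bsup>-l\<^esup>\<close>.
\<close>

lemma lp_geometric:
  fixes u :: "nat \<Rightarrow> 'a::real_normed_field"
  assumes p: "p \<ge> 1" and d: "d \<ge> 0" and u: "u 0 = 0" "\<And>l. norm (u l) \<le> d * (1 / 2) ^ l"
  shows "u \<in> lp p" "lp_norm p u \<le> 2 * d"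
proof -
  have le: "norm (u l) powr p \<le> d powr p * (1 / 2) ^ l" for l
  proof -
    have "norm (u l) powr p \<le> (d * (1 / 2) ^ l) powr p"
      using u(2)[of l] p by (intro powr_mono2) auto
    also have "\<dots> = d powr p * ((1 / 2) ^ l) powr p" by (rule powr_mult)
    also have "((1 / 2) ^ l) powr p \<le> ((1 / 2 :: real) ^ l) powr 1"
      using p by (intro powr_mono') (auto simp: power_le_one)
    finally show ?thesis by (simp add: mult_left_mono)
  qed
  have g: "(\<lambda>l. d powr p * (1 / 2) ^ l) sums (d powr p * 2)"
    using geometric_sums[of "1 / 2 :: real"] by (intro sums_mult) simp
  have s: "summable (\<lambda>l. norm (u l) powr p)"
    by (rule summable_comparison_test'[OF sums_summable[OF g], of 0]) (use le in auto)
  then show m: "u \<in> lp p" using u(1) by (simp add: lp_def)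
  have "(\<Sum>l. norm (u l) powr p) \<le> d powr p * 2"
    using suminf_le[OF le s sums_summable[OF g]] sums_unique[OF g] by simp
  also have "\<dots> \<le> d powr p * 2 powr p"
    using p powr_mono[of 1 p 2] by (intro mult_left_mono) auto
  also have "\<dots> = (2 * d) powr p" by (simp add: powr_mult mult.commute)
  finally show "lp_norm p u \<le> 2 * d" using d by (intro lp_norm_le[OF p m]) auto
qed

lemma norm_coordinate_le_lp_norm:
  assumes "p \<ge> 1" "u \<in> lp p"
  shows "norm (u l) \<le> lp_norm p u"
proof -
  have "norm (u l) powr p \<le> (\<Sum>n. norm (u n) powr p)"
    using assms sum_le_suminf[of "\<lambda>n. norm (u n) powr p" "{l}"] by (auto simp: lp_def)
  then have "(norm (u l) powr p) powr (1 / p) \<le> lp_norm p u"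
    unfolding lp_norm_def using assms by (intro powr_mono2) auto
  then show ?thesis using assms by (simp add: powr_powr)
qed

lemma openin_coordinate_ball:
  assumes p: "p \<ge> 1"
  shows "openin (lp_topology p) {u \<in> lp p. dist (u l) (c::'a::real_normed_field) < e}"
proof -
  interpret Metric_space "lp p :: (nat \<Rightarrow> 'a) set" "lp_dist p" by (rule Metric_space_lp[OF p])
  show ?thesis
    unfolding lp_topology_def openin_mtopology
  proof (intro conjI ballI allI impI)
    fix u :: "nat \<Rightarrow> 'a" assume u: "u \<in> {u \<in> lp p. dist (u l) c < e}"
    have "mball u (e - dist (u l) c) \<subseteq> {u \<in> lp p. dist (u l) c < e}"
    proof
      fix u' assume u': "u' \<in> mball u (e - dist (u l) c)"
      have "dist (u l) (u' l) \<le> lp_dist p u u'"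
        using norm_coordinate_le_lp_norm[OF p lp_diff[OF p], of u u' l] u u'
        by (simp add: lp_dist_def dist_norm)
      then show "u' \<in> {u \<in> lp p. dist (u l) c < e}"
        using u' dist_triangle[of "u' l" c "u l"] by (simp add: dist_commute)
    qed
    then show "\<exists>r>0. mball u r \<subseteq> {u \<in> lp p. dist (u l) c < e}"
      using u by (intro exI[of _ "e - dist (u l) c"]) auto
  qed auto
qed

lemma lp_tail:
  fixes y :: "nat \<Rightarrow> 'a::real_normed_field"
  assumes p: "p \<ge> 1" and y: "y \<in> lp p" and e: "e > 0"
  obtains K0 where
    "\<And>K. K \<ge> K0 \<Longrightarrow> (\<lambda>l. if l \<le> K then 0 else y l) \<in> lp p"
    "\<And>K. K \<ge> K0 \<Longrightarrow> lp_norm p (\<lambda>l. if l \<le> K then 0 else y l) \<le> e"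
proof -
  have s: "summable (\<lambda>l. norm (y l) powr p)" using y by (simp add: lp_def)
  obtain K0 where K0: "\<And>n. n \<ge> K0 \<Longrightarrow> norm (\<Sum>i. norm (y (i + n)) powr p) < e powr p"
    using suminf_exist_split[OF _ s, of "e powr p"] e by auto
  have "(\<lambda>l. if l \<le> K then 0 else y l) \<in> lp p \<and>
    lp_norm p (\<lambda>l. if l \<le> K then 0 else y l) \<le> e" if K: "K \<ge> K0" for K
  proof -
    let ?t = "\<lambda>l. if l \<le> K then 0 else y l"
    have st: "summable (\<lambda>l. norm (?t l) powr p)"
      by (rule summable_comparison_test'[OF s, of 0]) auto
    then have m: "?t \<in> lp p" using y by (simp add: lp_def)
    have "(\<Sum>l. norm (?t l) powr p) = (\<Sum>l. norm (?t (l + Suc K)) powr p)"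
      using suminf_split_initial_segment[OF st, of "Suc K"] by simp
    also have "\<dots> = (\<Sum>l. norm (y (l + Suc K)) powr p)" by simp
    also have "\<dots> \<le> e powr p" using K0[of "Suc K"] K by simp
    finally show ?thesis using m e by (auto intro!: lp_norm_le[OF p m])
  qed
  then show thesis using that by blast
qed

text \<open>
  Hitting an open set reduces to finitely many approximate coordinates and a geometrically small
  tail. The cut-off \<open>K\<close> may be enlarged at will, so that two open sets can be served with the same
  cut-off.
\<close>

lemma lp_open_contains_box:
  fixes U :: "(nat \<Rightarrow> 'a::real_normed_field) set"
  assumes p: "p \<ge> 1" and U: "openin (lp_topology p) U" "U \<noteq> {}"
  obtains y :: "nat \<Rightarrow> 'a" and d K0 where "d > 0"
    "\<And>K u. \<lbrakk>K \<ge> K0; u 0 = 0; \<And>l. \<lbrakk>1 \<le> l; l \<le> K\<rbrakk> \<Longrightarrow> norm (u l - y l) \<le> d * (1 / 2) ^ l;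
       \<And>l. l > K \<Longrightarrow> norm (u l) \<le> d * (1 / 2) ^ l\<rbrakk> \<Longrightarrow> u \<in> U"
proof -
  interpret Metric_space "lp p :: (nat \<Rightarrow> 'a) set" "lp_dist p" by (rule Metric_space_lp[OF p])
  obtain y where y: "y \<in> U" using U(2) by blast
  then obtain e where e: "e > 0" "mball y e \<subseteq> U"
    using U(1) unfolding lp_topology_def openin_mtopology by blast
  have ylp: "y \<in> lp p"
    using U(1) y unfolding lp_topology_def openin_mtopology by blast
  obtain K0 where K0:
    "\<And>K. K \<ge> K0 \<Longrightarrow> (\<lambda>l. if l \<le> K then 0 else y l) \<in> lp p"
    "\<And>K. K \<ge> K0 \<Longrightarrow> lp_norm p (\<lambda>l. if l \<le> K then 0 else y l) \<le> e / 2"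
    using lp_tail[OF p ylp, of "e / 2"] e(1) by auto
  show thesis
  proof (rule that[of "e / 8" K0 y])
    fix K u
    assume K: "K \<ge> K0" and u: "u 0 = 0" and
      near: "\<And>l. \<lbrakk>1 \<le> l; l \<le> K\<rbrakk> \<Longrightarrow> norm (u l - y l) \<le> e / 8 * (1 / 2) ^ l" and
      far: "\<And>l. l > K \<Longrightarrow> norm (u l) \<le> e / 8 * (1 / 2) ^ l"
    let ?t = "\<lambda>l. if l \<le> K then 0 else y l"
    let ?h = "\<lambda>l. if l \<le> K then y l - u l else - u l"
    have y0: "y 0 = 0" using ylp by (simp add: lp_def)
    have h: "?h \<in> lp p" "lp_norm p ?h \<le> 2 * (e / 8)"
    proof -
      have "norm (?h l) \<le> e / 8 * (1 / 2) ^ l" for l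
        using near[of l] far[of l] u y0 e(1) by (cases "l = 0") (auto simp: norm_minus_commute)
      then show "?h \<in> lp p" "lp_norm p ?h \<le> 2 * (e / 8)"
        using lp_geometric[OF p, of "e / 8" ?h] e(1) u y0 by auto
    qed
    have sum: "(\<lambda>l. ?h l + ?t l) = (\<lambda>l. y l - u l)" by auto
    have "lp_dist p y u \<le> 2 * (e / 8) + e / 2"
      using lp_add_norm(2)[OF p h(1) K0(1)[OF K]] h(2) K0(2)[OF K]
      unfolding sum lp_dist_def by linarith
    moreover have "(\<lambda>l. y l - u l) \<in> lp p"
      using lp_add_norm(1)[OF p h(1) K0(1)[OF K]] unfolding sum .
    then have "u \<in> lp p" using lp_diff[OF p ylp, of "\<lambda>l. y l - u l"] by simp
    ultimately show "u \<in> U" using e ylp by (intro subsetD[OF e(2)]) auto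
  qed (use e(1) in auto)
qed

section \<open>Vectors with prescribed visits\<close>

text \<open>
  The weights whose partial products are proportional to \<open>V\<close>.
\<close>

definition ratio_weights :: "(nat \<Rightarrow> 'a::real_normed_field) \<Rightarrow> nat \<Rightarrow> 'a" where
  "ratio_weights V i = V i / V (i - 1)"

lemma weighted_shift_funpow:
  assumes "\<And>l. V l \<noteq> 0" "x 0 = 0"
  shows "(weighted_shift (ratio_weights V) ^^ n) x l = (if l = 0 then 0 else V (l + n) / V l * x (l + n))"
proof (induction n arbitrary: l)
  case 0
  then show ?case using assms by simp
next
  case (Suc n)
  have "(weighted_shift (ratio_weights V) ^^ Suc n) x l = (if l = 0 then 0 else
      ratio_weights V (Suc l) * (weighted_shift (ratio_weights V) ^^ n) x (Suc l))"
    by (simp add: weighted_shift_def)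
  also have "\<dots> = (if l = 0 then 0 else V (l + Suc n) / V l * x (l + Suc n))"
    unfolding Suc.IH using assms(1)[of "Suc l"] by (simp add: ratio_weights_def)
  finally show ?case .
qed

text \<open>
  After \<open>pos q\<close> the word \<open>a (ruler q)\<close> is written, divided by \<open>V\<close>, for all indices \<open>q\<close> in \<open>G\<close>;
  the shift with product sequence \<open>V\<close> then shows \<open>a (ruler q) / V\<close> at time \<open>pos q\<close>.
\<close>

definition hitting_vector ::
    "(nat \<Rightarrow> nat \<Rightarrow> 'a) \<Rightarrow> (nat \<Rightarrow> 'a) \<Rightarrow> nat set \<Rightarrow> nat \<Rightarrow> 'a::real_normed_field" where
  "hitting_vector a V G l = (if blk l \<in> G then a (ruler (blk l)) (off l) / V l else 0)"

context
  fixes a :: "nat \<Rightarrow> nat \<Rightarrow> 'a::real_normed_field" and V :: "nat \<Rightarrow> 'a"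
  assumes support: "\<And>j k. a j k \<noteq> 0 \<Longrightarrow> 1 \<le> k \<and> k \<le> j"
    and small: "\<And>j k. norm (a j k) \<le> 2 ^ j"
    and growth: "\<And>l. 4 ^ l \<le> norm (V l)"
begin

lemma V_nonzero: "V l \<noteq> 0"
proof
  assume "V l = 0"
  moreover have "0 < (4::real) ^ l" by simp
  ultimately show False using growth[of l] by (simp only: norm_zero)
qed

lemma norm_divide_V_le:
  assumes "s + ruler r \<le> l"
  shows "norm (a (ruler r) k / V l) \<le> (1 / 2) ^ s * (1 / 2) ^ l"
proof -
  have "(2::real) ^ (s + ruler r) \<le> 2 ^ l" using assms by (intro power_increasing) auto
  then have *: "(2::real) ^ (s + ruler r) / 2 ^ l \<le> 1" by simp
  have "norm (a (ruler r) k / V l) \<le> 2 ^ ruler r / 4 ^ l"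
    unfolding norm_divide using small[of "ruler r" k] growth[of l] by (intro frac_le) auto
  also have "(4::real) ^ l = 2 ^ l * 2 ^ l"
    by (simp flip: power_mult_distrib)
  also have "2 ^ ruler r / (2 ^ l * 2 ^ l) = 2 ^ (s + ruler r) / 2 ^ l * ((1 / 2) ^ s * (1 / 2 :: real) ^ l)"
    by (simp add: power_add power_one_over)
  also have "\<dots> \<le> 1 * ((1 / 2) ^ s * (1 / 2) ^ l)"
    using * by (intro mult_right_mono) auto
  finally show ?thesis by simp
qed

lemma hitting_vector_0: "hitting_vector a V G 0 = 0"
proof -
  have "off 0 = 0" by (simp add: off_def)
  moreover have "a j 0 = 0" for j using support[of j 0] by linarith
  ultimately show ?thesis by (simp add: hitting_vector_def)
qed

lemma orbit_hitting_vector: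
  "(weighted_shift (ratio_weights V) ^^ n) (hitting_vector a V G) l
    = (if l = 0 then 0 else V (l + n) / V l * hitting_vector a V G (l + n))"
  by (rule weighted_shift_funpow) (rule V_nonzero hitting_vector_0)+

lemma hitting_vector_in_lp:
  assumes "p \<ge> 1"
  shows "hitting_vector a V G \<in> lp p"
proof (rule lp_geometric(1)[OF assms, of 1])
  fix l
  have "ruler (blk l) \<le> l"
    using pos_ge(3)[of "blk l"] pos_blk_le[of l] by linarith
  then show "norm (hitting_vector a V G l) \<le> 1 * (1 / 2) ^ l"
    using norm_divide_V_le[of 0 "blk l" l] by (simp add: hitting_vector_def)
qed (auto simp: hitting_vector_0)

text \<open>
  At coordinate \<open>l\<close> and time \<open>pos q\<close> one reads the entry at \<open>l + pos q\<close>. If it belongs to the block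
  of \<open>q\<close>, it is exactly the wanted value. Otherwise it belongs to a later block \<open>r\<close>, it has size at most
  \<open>2\<^bsup>ruler r\<^esup> / 4\<^sup>l\<close> after the shift, and \<open>l > ruler q + ruler r\<close>.
\<close>

lemma hitting_vector_orbit:
  assumes "q \<in> G"
  shows "norm ((weighted_shift (ratio_weights V) ^^ pos q) (hitting_vector a V G) l
      - a (ruler q) l / V l) \<le> (1 / 2) ^ ruler q * (1 / 2) ^ l"
proof (cases "l = 0")
  case True
  moreover have "a (ruler q) 0 = 0" using support[of "ruler q" 0] by linarith
  ultimately show ?thesis by (simp add: orbit_hitting_vector)
next
  case False
  let ?h = "hitting_vector a V G"
  have orbit: "(weighted_shift (ratio_weights V) ^^ pos q) ?h l
      = (if blk (l + pos q) \<in> G then a (ruler (blk (l + pos q))) (off (l + pos q)) / V l else 0)"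
    unfolding orbit_hitting_vector hitting_vector_def using False V_nonzero[of "l + pos q"] by simp
  show ?thesis
  proof (cases "blk (l + pos q) = q")
    case True
    then have "off (l + pos q) = l" by (simp add: off_def)
    then show ?thesis unfolding orbit using True assms by simp
  next
    case neq: False
    have "ruler q + ruler (blk (l + pos q)) < l"
      using blk_gap[OF _ neq] by simp
    then have "a (ruler q) l = 0" and "norm (a (ruler (blk (l + pos q))) (off (l + pos q)) / V l)
        \<le> (1 / 2) ^ ruler q * (1 / 2) ^ l"
      using support[of "ruler q" l] by (linarith, intro norm_divide_V_le) simp
    then show ?thesis unfolding orbit by simp
  qed
qed

text \<open>
  Every open set is visited at time \<open>pos q\<close> as soon as the word written there matches finitely many
  prescribed values \<open>y\<close> (a point of the open set, multiplied by \<open>V\<close>) and its class is large enough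
  for the error of \<open>hitting_vector_orbit\<close> to be small.
\<close>

lemma hitting_vector_hits_open:
  assumes p: "p \<ge> 1" and U: "openin (lp_topology p) U" "U \<noteq> {}"
  obtains y d K0 N where "d > 0"
    "\<And>K j q. \<lbrakk>K \<ge> K0; j \<ge> N; \<And>k. k > K \<Longrightarrow> a j k = 0;
       \<And>k. \<lbrakk>1 \<le> k; k \<le> K\<rbrakk> \<Longrightarrow> norm (a j k - y k) \<le> d; q \<in> G; ruler q = j\<rbrakk>
      \<Longrightarrow> (weighted_shift (ratio_weights V) ^^ pos q) (hitting_vector a V G) \<in> U"
proof (rule lp_open_contains_box[OF p U])
  fix y :: "nat \<Rightarrow> 'a" and d :: real and K0 :: nat
  assume d: "d > 0" and box:
    "\<And>K u. \<lbrakk>K \<ge> K0; u 0 = 0; \<And>l. \<lbrakk>1 \<le> l; l \<le> K\<rbrakk> \<Longrightarrow> norm (u l - y l) \<le> d * (1 / 2) ^ l;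
       \<And>l. l > K \<Longrightarrow> norm (u l) \<le> d * (1 / 2) ^ l\<rbrakk> \<Longrightarrow> u \<in> U"
  have "0 < d / 2" using d by simp
  then obtain N where N: "(1 / 2) ^ N < d / 2"
    using real_arch_pow_inv[of "d / 2" "1 / 2"] by fastforce
  show thesis
  proof (rule that[of "d / 2" K0 N "\<lambda>k. V k * y k"])
    fix K j q
    assume K: "K \<ge> K0" and j: "j \<ge> N" "ruler q = j" and q: "q \<in> G"
      and zero: "\<And>k. k > K \<Longrightarrow> a j k = 0"
      and near: "\<And>k. \<lbrakk>1 \<le> k; k \<le> K\<rbrakk> \<Longrightarrow> norm (a j k - V k * y k) \<le> d / 2"
    let ?u = "(weighted_shift (ratio_weights V) ^^ pos q) (hitting_vector a V G)"
    have "(1 / 2 :: real) ^ j \<le> (1 / 2) ^ N" using j(1) by (intro power_decreasing) auto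
    then have "(1 / 2) ^ j \<le> d / 2" using N by linarith
    then have "(1 / 2) ^ j * (1 / 2) ^ l \<le> d / 2 * (1 / 2) ^ l" for l :: nat
      by (intro mult_right_mono) auto
    then have orbit: "norm (?u l - a j l / V l) \<le> d / 2 * (1 / 2) ^ l" for l
      using hitting_vector_orbit[OF q, of l] unfolding j(2) by (rule order_trans[rotated])
    show "?u \<in> U"
    proof (rule box[OF K])
      show "?u 0 = 0"
        by (simp add: orbit_hitting_vector)
    next
      fix l
      assume l: "1 \<le> l" "l \<le> K"
      have "norm (a j l / V l - y l) = norm (a j l - V l * y l) / norm (V l)"
        using V_nonzero[of l] by (simp add: diff_divide_distrib flip: norm_divide)
      also have "\<dots> \<le> (d / 2) / 2 ^ l"
      proof (rule frac_le)
        have "(2::real) ^ l \<le> 4 ^ l" by (intro power_mono) auto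
        then show "2 ^ l \<le> norm (V l)" using growth[of l] by (rule order_trans)
      qed (use near l d in auto)
      also have "(d / 2) / 2 ^ l = d / 2 * (1 / 2) ^ l" by (simp add: power_one_over)
      finally have "norm (?u l - a j l / V l) + norm (a j l / V l - y l)
          \<le> d / 2 * (1 / 2) ^ l + d / 2 * (1 / 2) ^ l"
        by (rule add_mono[OF orbit])
      also have "\<dots> = d * (1 / 2) ^ l" unfolding distrib_right[symmetric] by simp
      finally have sum: "norm (?u l - a j l / V l) + norm (a j l / V l - y l) \<le> d * (1 / 2) ^ l" .
      have "dist (?u l) (y l) \<le> dist (?u l) (a j l / V l) + dist (a j l / V l) (y l)"
        by (rule dist_triangle)
      then show "norm (?u l - y l) \<le> d * (1 / 2) ^ l"
        using sum unfolding dist_norm by (rule order_trans)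
    next
      fix l
      assume l: "l > K"
      have "norm (?u l) \<le> d / 2 * (1 / 2) ^ l"
        using orbit[of l] unfolding zero[OF l] by simp
      also have "\<dots> \<le> d * (1 / 2) ^ l"
        using d by (intro mult_right_mono) auto
      finally show "norm (?u l) \<le> d * (1 / 2) ^ l" .
    qed
  qed (use d in auto)
qed

end

text \<open>
  The vector with all indices in use is frequently hypercyclic: by \<open>c_dense\<close> some word of large
  class matches a given target, and the times of one class have positive lower density.
\<close>

lemma frequently_hypercyclic_ratio_weights:
  fixes c :: "nat \<Rightarrow> nat \<Rightarrow> 'a::real_normed_field" and P :: "nat \<Rightarrow> 'a"
  assumes p: "p \<ge> 1"
    and c: "\<And>j k. c j k \<noteq> 0 \<Longrightarrow> 1 \<le> k \<and> k \<le> j" "\<And>j k. norm (c j k) \<le> 2 ^ j"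
      "\<And>l. 4 ^ l \<le> norm (P l)"
    and c_dense: "\<And>d N n y. d > 0 \<Longrightarrow>
      \<exists>j\<ge>N. (\<forall>k>n. c j k = 0) \<and> (\<forall>k. 1 \<le> k \<and> k \<le> n \<longrightarrow> norm (c j k - y k) \<le> d)"
  shows "frequently_hypercyclic (lp_topology p) (weighted_shift (ratio_weights P))"
  unfolding frequently_hypercyclic_def topspace_lp_topology[OF p]
proof (intro bexI allI impI)
  show "hitting_vector c P UNIV \<in> lp p" by (rule hitting_vector_in_lp[OF c p])
  fix U :: "(nat \<Rightarrow> 'a) set" assume U: "openin (lp_topology p) U \<and> U \<noteq> {}"
  show "lower_density {n. (weighted_shift (ratio_weights P) ^^ n) (hitting_vector c P UNIV) \<in> U} > 0"
  proof (rule hitting_vector_hits_open[OF c p conjunct1[OF U] conjunct2[OF U], where G = UNIV])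
    fix y d K0 N
    assume d: "(d::real) > 0" and hits:
      "\<And>K j q. \<lbrakk>K0 \<le> K; N \<le> j; \<And>k. K < k \<Longrightarrow> c j k = 0;
         \<And>k. \<lbrakk>1 \<le> k; k \<le> K\<rbrakk> \<Longrightarrow> norm (c j k - y k) \<le> d; q \<in> UNIV; ruler q = j\<rbrakk>
        \<Longrightarrow> (weighted_shift (ratio_weights P) ^^ pos q) (hitting_vector c P UNIV) \<in> U"
    obtain j where j: "j \<ge> N" "\<forall>k>K0. c j k = 0" "\<forall>k. 1 \<le> k \<and> k \<le> K0 \<longrightarrow> norm (c j k - y k) \<le> d"
      using c_dense[OF d] by blast
    have "(weighted_shift (ratio_weights P) ^^ pos q) (hitting_vector c P UNIV) \<in> U"
      if "ruler q = j" for q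
      by (rule hits[of K0 j q]) (use j that in auto)
    then show ?thesis by (intro lower_density_class[of j]) auto
  qed
qed

section \<open>Two weight sequences with prescribed ratios\<close>

text \<open>
  The pair of words \<open>a j\<close>, \<open>b j\<close> of length \<open>K j\<close> is pattern number \<open>j\<close>. The quotients of its
  entries lie between \<open>2\<^bsup>-\<beta> j\<^esup>\<close> and \<open>2\<^bsup>\<beta> j\<^esup>\<close>. In \<open>cheap\<close>, the number \<open>2 \<beta> j\<close> is the loss, as an
  exponent of 2, that one letter causes to the products of weights. By \<open>dense\<close>, every target of every length is
  approximated by patterns of arbitrarily large number.
\<close>

locale pattern_sequence =
  fixes a b :: "nat \<Rightarrow> nat \<Rightarrow> 'a::real_normed_field" and K \<beta> :: "nat \<Rightarrow> nat"
  assumes window: "K j \<le> j"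
    and cheap: "2 * \<beta> j * K j \<le> j"
    and nonzero: "\<lbrakk>1 \<le> k; k \<le> K j\<rbrakk> \<Longrightarrow> a j k \<noteq> 0 \<and> b j k \<noteq> 0"
    and zero: "\<not> (1 \<le> k \<and> k \<le> K j) \<Longrightarrow> a j k = 0 \<and> b j k = 0"
    and small: "norm (a j k) \<le> 2 ^ j" "norm (b j k) \<le> 2 ^ j"
    and comparable: "norm (a j k) \<le> 2 ^ \<beta> j * norm (b j k)" "norm (b j k) \<le> 2 ^ \<beta> j * norm (a j k)"
    and dense: "d > 0 \<Longrightarrow> \<exists>j\<ge>N. K j = n \<and>
      (\<forall>k\<in>{1..n}. norm (a j k - y k) \<le> d \<and> norm (b j k - z k) \<le> d)"
begin

definition in_window :: "nat \<Rightarrow> bool" where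
  "in_window l \<longleftrightarrow> 1 \<le> off l \<and> off l \<le> K (ruler (blk l))"

definition ratio :: "nat \<Rightarrow> 'a" where
  "ratio l = (if blk l \<in> good \<and> in_window l
    then b (ruler (blk l)) (off l) / a (ruler (blk l)) (off l) else 1)"

text \<open>
  The products are built from a common positive factor \<open>base\<close>, and \<open>amp\<close> is a bound, as an exponent of
  2, for the size of the ratio and of its inverse. Both products lie between \<open>base l\<close> and
  \<open>base l * 2 ^ (2 * amp l)\<close>, so their growth from \<open>l\<close> to \<open>l + 1\<close> is at most 8 if \<open>base\<close>, next to its growth
  \<open>8\<^sup>l\<close>, loses the factor \<open>2 ^ (2 * amp (l + 1))\<close>. The exponent of the accumulated loss is \<open>budget\<close>:
  every block \<open>q\<close> spends \<open>2 * \<beta> (ruler q)\<close> per step, up to a total of \<open>ruler q\<close>. By \<open>cheap\<close> this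
  limit does not cut in before the window has ended.
\<close>

definition amp :: "nat \<Rightarrow> nat" where
  "amp l = (if in_window l then \<beta> (ruler (blk l)) else 0)"

definition budget :: "nat \<Rightarrow> nat" where
  "budget l = (\<Sum>i<blk l. ruler i) + min (2 * \<beta> (ruler (blk l)) * off l) (ruler (blk l))"

definition base :: "nat \<Rightarrow> real" where
  "base l = 8 ^ l / 2 ^ budget l"

definition V :: "nat \<Rightarrow> 'a" where
  "V l = of_real (base l * 2 ^ amp l)"

definition W :: "nat \<Rightarrow> 'a" where
  "W l = ratio l * V l"

text \<open>
  The sum of the classes up to \<open>q\<close> is what \<open>pos q\<close> provides as gaps.
\<close>

lemma budget_le: "budget l \<le> l"
proof -
  have "budget l \<le> (\<Sum>i<Suc (blk l). ruler i)" by (simp add: budget_def)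
  also have "\<dots> \<le> pos (blk l)" by (rule pos_ge)
  finally show ?thesis using pos_blk_le[of l] by linarith
qed

lemma budget_Suc: "budget l + 2 * amp (Suc l) \<le> budget (Suc l)"
  using blk_Suc[of l]
proof
  assume same: "blk (Suc l) = blk l \<and> off (Suc l) = Suc (off l)"
  let ?j = "ruler (blk l)"
  show ?thesis
  proof (cases "in_window (Suc l)")
    case True
    then have "2 * \<beta> ?j * Suc (off l) \<le> 2 * \<beta> ?j * K ?j"
      using same by (intro mult_left_mono) (auto simp: in_window_def)
    then have "2 * \<beta> ?j * Suc (off l) \<le> ?j" using cheap[of ?j] by (rule order_trans)
    then show ?thesis using same True by (simp add: budget_def amp_def)
  next
    case False
    have "2 * \<beta> ?j * off l \<le> 2 * \<beta> ?j * Suc (off l)" by (intro mult_left_mono) auto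
    then show ?thesis using same False by (simp add: budget_def amp_def)
  qed
next
  assume "blk (Suc l) = Suc (blk l) \<and> off (Suc l) = 0"
  then show ?thesis by (simp add: budget_def amp_def in_window_def)
qed

lemma base_ge: "4 ^ l \<le> base l"
proof -
  have "(4::real) ^ l * 2 ^ budget l \<le> 4 ^ l * 2 ^ l"
    using budget_le[of l] by (intro mult_left_mono power_increasing) auto
  also have "\<dots> = 8 ^ l" by (simp flip: power_mult_distrib)
  finally show ?thesis by (simp add: base_def field_simps)
qed

lemma base_pos: "0 < base l"
  by (simp add: base_def)

lemma base_Suc: "base (Suc l) * 2 ^ (2 * amp (Suc l)) \<le> 8 * base l"
proof -
  have "(2::real) ^ (budget l + 2 * amp (Suc l)) \<le> 2 ^ budget (Suc l)"
    using budget_Suc[of l] by (intro power_increasing) auto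
  then have "2 ^ (2 * amp (Suc l)) / (2::real) ^ budget (Suc l) \<le> 1 / 2 ^ budget l"
    by (simp add: power_add field_simps)
  then have "8 ^ Suc l * (2 ^ (2 * amp (Suc l)) / (2::real) ^ budget (Suc l)) \<le> 8 ^ Suc l * (1 / 2 ^ budget l)"
    by (intro mult_left_mono) auto
  then show ?thesis by (simp add: base_def)
qed

lemma ratio_bounds: "1 \<le> 2 ^ amp l * norm (ratio l)" "norm (ratio l) \<le> 2 ^ amp l"
proof -
  let ?j = "ruler (blk l)"
  have "1 \<le> 2 ^ amp l * norm (ratio l) \<and> norm (ratio l) \<le> 2 ^ amp l"
  proof (cases "blk l \<in> good \<and> in_window l")
    case True
    then have "a ?j (off l) \<noteq> 0" using nonzero[of "off l" ?j] by (simp add: in_window_def)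
    then show ?thesis
      using True comparable[of ?j "off l"]
      by (simp add: ratio_def amp_def norm_divide field_simps)
  qed (auto simp: ratio_def amp_def)
  then show "1 \<le> 2 ^ amp l * norm (ratio l)" "norm (ratio l) \<le> 2 ^ amp l" by auto
qed

lemma norm_V: "norm (V l) = base l * 2 ^ amp l"
  using base_pos[of l] by (simp add: V_def norm_mult norm_power)

lemma norm_V_bounds: "base l \<le> norm (V l)" "norm (V l) \<le> base l * 2 ^ (2 * amp l)"
proof -
  have "(2::real) ^ amp l \<le> 2 ^ (2 * amp l)" by (intro power_increasing) auto
  then show "base l \<le> norm (V l)" "norm (V l) \<le> base l * 2 ^ (2 * amp l)"
    using base_pos[of l] by (auto simp: norm_V)
qed

lemma norm_W_bounds: "base l \<le> norm (W l)" "norm (W l) \<le> base l * 2 ^ (2 * amp l)"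
proof -
  have W: "norm (W l) = base l * (2 ^ amp l * norm (ratio l))"
    by (simp add: W_def norm_mult norm_V)
  show "base l \<le> norm (W l)"
    unfolding W using ratio_bounds(1) base_pos[of l] by simp
  have "norm (W l) \<le> base l * (2 ^ amp l * 2 ^ amp l)"
    unfolding W using ratio_bounds(2) base_pos[of l] by simp
  also have "2 ^ amp l * 2 ^ amp l = (2::real) ^ (2 * amp l)"
    by (simp add: mult_2 power_add)
  finally show "norm (W l) \<le> base l * 2 ^ (2 * amp l)" .
qed

lemma growth: "4 ^ l \<le> norm (V l)" "4 ^ l \<le> norm (W l)"
  using base_ge[of l] norm_V_bounds(1)[of l] norm_W_bounds(1)[of l] by linarith+

lemma bounded_ratio_weights:
  assumes "\<And>l. base l \<le> norm (P l)" "\<And>l. norm (P l) \<le> base l * 2 ^ (2 * amp l)"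
  shows "bounded_weights (ratio_weights (P :: nat \<Rightarrow> 'a))"
  unfolding bounded_weights_def bounded_iff
proof (intro exI ballI)
  fix x assume "x \<in> ratio_weights P ` {1..}"
  then obtain l where "x = ratio_weights P (Suc l)" by (auto dest!: Suc_le_D)
  then have "norm x = norm (P (Suc l)) / norm (P l)"
    by (simp add: ratio_weights_def norm_divide)
  also have "\<dots> \<le> (8 * base l) / base l"
    using assms(1)[of l] order_trans[OF assms(2) base_Suc[of l]] base_pos[of l]
    by (intro frac_le) auto
  also have "\<dots> = 8" using base_pos[of l] by simp
  finally show "norm x \<le> 8" .
qed

lemma support: "a j k \<noteq> 0 \<Longrightarrow> 1 \<le> k \<and> k \<le> j" "b j k \<noteq> 0 \<Longrightarrow> 1 \<le> k \<and> k \<le> j"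
  using zero[of k j] window[of j] by force+

lemma frequently_hypercyclic_V:
  assumes p: "p \<ge> 1"
  shows "frequently_hypercyclic (lp_topology p) (weighted_shift (ratio_weights V))"
proof (rule frequently_hypercyclic_ratio_weights[OF p support(1) small(1) growth(1)])
  fix d :: real and N n :: nat and y :: "nat \<Rightarrow> 'a" assume "d > 0"
  from dense[OF this, of N n y y] obtain j where j: "j \<ge> N" "K j = n"
    "\<forall>k\<in>{1..n}. norm (a j k - y k) \<le> d \<and> norm (b j k - y k) \<le> d" by blast
  then show "\<exists>j\<ge>N. (\<forall>k>n. a j k = 0) \<and> (\<forall>k. 1 \<le> k \<and> k \<le> n \<longrightarrow> norm (a j k - y k) \<le> d)"
    using zero[of _ j] by (intro exI[of _ j]) auto
qed

lemma frequently_hypercyclic_W: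
  assumes p: "p \<ge> 1"
  shows "frequently_hypercyclic (lp_topology p) (weighted_shift (ratio_weights W))"
proof (rule frequently_hypercyclic_ratio_weights[OF p support(2) small(2) growth(2)])
  fix d :: real and N n :: nat and y :: "nat \<Rightarrow> 'a" assume "d > 0"
  from dense[OF this, of N n y y] obtain j where j: "j \<ge> N" "K j = n"
    "\<forall>k\<in>{1..n}. norm (a j k - y k) \<le> d \<and> norm (b j k - y k) \<le> d" by blast
  then show "\<exists>j\<ge>N. (\<forall>k>n. b j k = 0) \<and> (\<forall>k. 1 \<le> k \<and> k \<le> n \<longrightarrow> norm (b j k - y k) \<le> d)"
    using zero[of _ j] by (intro exI[of _ j]) auto
qed

text \<open>
  On the good windows \<open>b / W = a / V\<close>: one and the same vector serves both shifts.
\<close>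

lemma hitting_vectors_agree: "hitting_vector b W good = hitting_vector a V good"
proof
  fix l
  let ?j = "ruler (blk l)"
  show "hitting_vector b W good l = hitting_vector a V good l"
  proof (cases "blk l \<in> good \<and> in_window l")
    case True
    then have "a ?j (off l) \<noteq> 0" "b ?j (off l) \<noteq> 0"
      using nonzero[of "off l" ?j] by (auto simp: in_window_def)
    then show ?thesis using True by (simp add: hitting_vector_def W_def ratio_def)
  next
    case False
    then show ?thesis using zero[of "off l" ?j] by (auto simp: hitting_vector_def in_window_def)
  qed
qed

lemma disjoint_upper_frequently_hypercyclic_V_W:
  assumes p: "p \<ge> 1"
  shows "disjoint_upper_frequently_hypercyclic (lp_topology p)
    (weighted_shift (ratio_weights V)) (weighted_shift (ratio_weights W))"
  unfolding disjoint_upper_frequently_hypercyclic_def topspace_lp_topology[OF p]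
proof (intro bexI allI impI)
  let ?x = "hitting_vector a V good"
  let ?S = "weighted_shift (ratio_weights V)" and ?T = "weighted_shift (ratio_weights W)"
  show "?x \<in> lp p" by (rule hitting_vector_in_lp[OF support(1) small(1) growth(1) p])
  fix U\<^sub>1 U\<^sub>2 :: "(nat \<Rightarrow> 'a) set"
  assume "openin (lp_topology p) U\<^sub>1 \<and> U\<^sub>1 \<noteq> {} \<and> openin (lp_topology p) U\<^sub>2 \<and> U\<^sub>2 \<noteq> {}"
  then have U: "openin (lp_topology p) U\<^sub>1" "U\<^sub>1 \<noteq> {}" "openin (lp_topology p) U\<^sub>2" "U\<^sub>2 \<noteq> {}" by auto
  show "upper_density {n. (?S ^^ n) ?x \<in> U\<^sub>1 \<and> (?T ^^ n) ?x \<in> U\<^sub>2} > 0"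
  proof (rule hitting_vector_hits_open[OF support(1) small(1) growth(1) p U(1,2), where G = good])
    fix y d K0 N
    assume d: "(d::real) > 0" and hits:
      "\<And>K j q. \<lbrakk>K0 \<le> K; N \<le> j; \<And>k. K < k \<Longrightarrow> a j k = 0;
         \<And>k. \<lbrakk>1 \<le> k; k \<le> K\<rbrakk> \<Longrightarrow> norm (a j k - y k) \<le> d; q \<in> good; ruler q = j\<rbrakk>
        \<Longrightarrow> (?S ^^ pos q) ?x \<in> U\<^sub>1"
    show ?thesis
    proof (rule hitting_vector_hits_open[OF support(2) small(2) growth(2) p U(3,4), where G = good])
      fix y' d' K0' N'
      assume d': "(d'::real) > 0" and hits':
        "\<And>K j q. \<lbrakk>K0' \<le> K; N' \<le> j; \<And>k. K < k \<Longrightarrow> b j k = 0;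
           \<And>k. \<lbrakk>1 \<le> k; k \<le> K\<rbrakk> \<Longrightarrow> norm (b j k - y' k) \<le> d'; q \<in> good; ruler q = j\<rbrakk>
          \<Longrightarrow> (?T ^^ pos q) (hitting_vector b W good) \<in> U\<^sub>2"
      obtain j where j: "j \<ge> max N N'" "K j = max K0 K0'"
        "\<forall>k\<in>{1..max K0 K0'}. norm (a j k - y k) \<le> min d d' \<and> norm (b j k - y' k) \<le> min d d'"
        using dense[of "min d d'" "max N N'" "max K0 K0'" y y'] d d' by auto
      have "(?S ^^ pos q) ?x \<in> U\<^sub>1 \<and> (?T ^^ pos q) ?x \<in> U\<^sub>2" if "ruler q = j" "q \<in> good" for q
      proof
        show "(?S ^^ pos q) ?x \<in> U\<^sub>1"
          by (rule hits[of "K j" j q]) (use j that zero[of _ j] in auto)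
        show "(?T ^^ pos q) ?x \<in> U\<^sub>2"
          unfolding hitting_vectors_agree[symmetric]
          by (rule hits'[of "K j" j q]) (use j that zero[of _ j] in auto)
      qed
      then show ?thesis by (intro upper_density_good_class[of j]) auto
    qed
  qed
qed

text \<open>
  Coordinate 1 lies in block 0, whose class is 0 and whose window is therefore empty.
\<close>

lemma ratio_1: "ratio 1 = 1"
proof -
  have "blk 1 = 0"
    by (rule blk_eqI) (simp_all add: pos_0 pos_Suc ruler_even ruler_double_Suc[of 0, simplified])
  moreover have "ruler 0 = 0" by (simp add: ruler_even)
  ultimately show ?thesis using window[of 0] by (auto simp: ratio_def in_window_def)
qed

text \<open>
  At a time \<open>n\<close> with \<open>n + 1\<close> outside the good blocks, \<open>W / V\<close> is 1 at \<open>n + 1\<close> and at 1, so the first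
  coordinates of the two iterates coincide and cannot be close to 0 and to 1 respectively.
\<close>

lemma not_disjoint_frequently_hypercyclic_V_W:
  assumes p: "p \<ge> 1"
  shows "\<not> disjoint_frequently_hypercyclic (lp_topology p)
    (weighted_shift (ratio_weights V)) (weighted_shift (ratio_weights W))"
proof
  let ?S = "weighted_shift (ratio_weights V)" and ?T = "weighted_shift (ratio_weights W)"
  define B where "B c = {u \<in> lp p. dist (u 1) (c::'a) < 1 / 2}" for c
  have B: "openin (lp_topology p) (B c)" "B c \<noteq> {}" for c
  proof -
    show "openin (lp_topology p) (B c)"
      unfolding B_def by (rule openin_coordinate_ball[OF p])
    let ?e = "\<lambda>l. if l = 1 then c else 0"
    have "norm (?e l) \<le> 2 * norm c * (1 / 2) ^ l" for l by auto
    then have "?e \<in> lp p" by (intro lp_geometric(1)[OF p, of "2 * norm c"]) auto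
    then have "?e \<in> B c" by (simp add: B_def)
    then show "B c \<noteq> {}" by blast
  qed
  assume "disjoint_frequently_hypercyclic (lp_topology p) ?S ?T"
  then obtain x where x: "x \<in> lp p" and "\<forall>V\<^sub>1 V\<^sub>2. openin (lp_topology p) V\<^sub>1 \<and> V\<^sub>1 \<noteq> {}
      \<and> openin (lp_topology p) V\<^sub>2 \<and> V\<^sub>2 \<noteq> {}
      \<longrightarrow> lower_density {n. (?S ^^ n) x \<in> V\<^sub>1 \<and> (?T ^^ n) x \<in> V\<^sub>2} > 0"
    unfolding disjoint_frequently_hypercyclic_def topspace_lp_topology[OF p] by (elim bexE)
  from spec[OF spec[OF this(2), of "B 0"], of "B 1"] B
  have pos: "lower_density {n. (?S ^^ n) x \<in> B 0 \<and> (?T ^^ n) x \<in> B 1} > 0" by simp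
  have x0: "x 0 = 0" using x by (simp add: lp_def)
  have nz: "V l \<noteq> 0" "W l \<noteq> 0" for l
    using growth[of l] zero_less_power[of "4::real" l] by (auto simp del: zero_less_power)
  have "{n. (?S ^^ n) x \<in> B 0 \<and> (?T ^^ n) x \<in> B 1} \<subseteq> {n. blk (Suc n) \<in> good}"
  proof (intro subsetI CollectI, elim CollectE conjE, rule ccontr)
    fix n assume n: "(?S ^^ n) x \<in> B 0" "(?T ^^ n) x \<in> B 1" "blk (Suc n) \<notin> good"
    have "(?T ^^ n) x 1 = W (Suc n) / W 1 * x (Suc n)"
      by (subst weighted_shift_funpow[where V = W and x = x, OF nz(2) x0]) simp
    also have "\<dots> = V (Suc n) / V 1 * x (Suc n)"
      using n(3) ratio_1 by (simp add: W_def ratio_def[of "Suc n"])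
    also have "\<dots> = (?S ^^ n) x 1"
      by (subst weighted_shift_funpow[where V = V and x = x, OF nz(1) x0]) simp
    finally have eq: "(?T ^^ n) x 1 = (?S ^^ n) x 1" .
    have "dist 0 (1::'a) \<le> dist ((?S ^^ n) x 1) 0 + dist ((?S ^^ n) x 1) 1"
      by (rule dist_triangle3)
    also have "\<dots> < 1 / 2 + 1 / 2"
    proof (rule add_strict_mono)
      show "dist ((?S ^^ n) x 1) 0 < 1 / 2" using n(1) unfolding B_def by blast
      show "dist ((?S ^^ n) x 1) 1 < 1 / 2" using n(2) unfolding B_def mem_Collect_eq eq by blast
    qed
    finally show False by simp
  qed
  from lower_density_good[OF this] pos show False by blast
qed

end

section \<open>Existence of the weights\<close>

text \<open>
  List the finite words over pairs of non-zero elements of a countable dense set so that each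
  occurs infinitely often, and replace word number \<open>j\<close> by the empty word if it is too expensive for
  \<open>j\<close>. Since every word is cheap for all large \<open>j\<close>, no word is lost.
\<close>

lemma ex_pattern_sequence:
  obtains a b :: "nat \<Rightarrow> nat \<Rightarrow> 'a::{real_normed_field, second_countable_topology}" and K \<beta>
  where "pattern_sequence a b K \<beta>"
proof -
  obtain D :: "'a set" where "countable D \<and> (\<forall>X. open X \<longrightarrow> X \<noteq> {} \<longrightarrow> (\<exists>x\<in>D. x \<in> X))"
    using countable_dense_exists by blast
  then have D: "countable D" "\<And>X. \<lbrakk>open X; X \<noteq> {}\<rbrakk> \<Longrightarrow> \<exists>x\<in>D. x \<in> X" by auto
  define L where "L = lists ((D - {0}) \<times> (D - {0}))"
  have L: "countable L" "L \<noteq> {}" "[] \<in> L"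
    using D(1) by (auto simp: L_def countable_lists)
  define fits where "fits s m \<longleftrightarrow> (\<forall>(u, v)\<in>set s. norm u \<le> 2 ^ m \<and> norm v \<le> 2 ^ m
      \<and> norm u \<le> 2 ^ m * norm v \<and> norm v \<le> 2 ^ m * norm u)" for s :: "('a \<times> 'a) list" and m
  (* The least exponent, so that the empty word costs nothing and fits every number. *)
  define bound where "bound s = (LEAST m. fits s m)" for s :: "('a \<times> 'a) list"
  have bound: "fits s (bound s)" if "s \<in> L" for s
  proof -
    have "\<exists>m. norm u \<le> 2 ^ m \<and> norm v \<le> 2 ^ m
        \<and> norm u \<le> 2 ^ m * norm v \<and> norm v \<le> 2 ^ m * norm u" if "(u, v) \<in> set s" for u v
    proof -
      have "(u, v) \<in> (D - {0}) \<times> (D - {0})" using that \<open>s \<in> L\<close> by (auto simp: L_def)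
      then have nz: "norm u > 0" "norm v > 0" by auto
      obtain m where "Max {norm u, norm v, norm u / norm v, norm v / norm u} < 2 ^ m"
        using real_arch_pow[of 2] by fastforce
      then have "norm u < 2 ^ m" "norm v < 2 ^ m" "norm u / norm v < 2 ^ m" "norm v / norm u < 2 ^ m"
        by simp_all
      then show ?thesis using nz by (intro exI[of _ m]) (simp add: pos_divide_less_eq less_imp_le)
    qed
    then obtain f where f: "\<And>u v. (u, v) \<in> set s \<Longrightarrow> norm u \<le> 2 ^ f u v \<and> norm v \<le> 2 ^ f u v
        \<and> norm u \<le> 2 ^ f u v * norm v \<and> norm v \<le> 2 ^ f u v * norm u" by metis
    have "fits s (\<Sum>(u, v)\<in>set s. f u v)"
      unfolding fits_def
    proof (intro ballI, clarify)
      fix u v assume uv: "(u, v) \<in> set s"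
      let ?m = "\<Sum>(u, v)\<in>set s. f u v"
      have "f u v \<le> ?m"
        using member_le_sum[OF uv, of "\<lambda>(u, v). f u v"] by simp
      then have le: "(2::real) ^ f u v \<le> 2 ^ ?m" by (intro power_increasing) auto
      have "2 ^ f u v * norm t \<le> 2 ^ ?m * norm t" for t :: 'a
        using le by (intro mult_right_mono) auto
      then show "norm u \<le> 2 ^ ?m \<and> norm v \<le> 2 ^ ?m
          \<and> norm u \<le> 2 ^ ?m * norm v \<and> norm v \<le> 2 ^ ?m * norm u"
        using f[OF uv] le by (meson order_trans)
    qed
    then have "\<exists>m. fits s m" by blast
    then show ?thesis unfolding bound_def by (rule LeastI_ex)
  qed
  define affordable where
    "affordable s j \<longleftrightarrow> length s \<le> j \<and> bound s \<le> j \<and> 2 * bound s * length s \<le> j" for s j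
  define pat where "pat j = (let s = from_nat_into L (fst (prod_decode j)) in
      if affordable s j then s else [])" for j
  define K where "K j = length (pat j)" for j
  define \<beta> where "\<beta> j = bound (pat j)" for j
  define entry where "entry j k = (if 1 \<le> k \<and> k \<le> K j then pat j ! (k - 1) else (0, 0))" for j k
  have pat_L: "pat j \<in> L" for j
    using L by (auto simp: pat_def Let_def intro: from_nat_into)
  have "bound [] = 0" by (simp add: bound_def fits_def)
  then have pat_affordable: "affordable (pat j) j" for j
    by (auto simp: pat_def Let_def affordable_def)
  have entry_set: "entry j k \<in> set (pat j)" if "1 \<le> k" "k \<le> K j" for j k
    using that by (auto simp: entry_def K_def)
  have entry_fits: "norm (fst (entry j k)) \<le> 2 ^ \<beta> j \<and> norm (snd (entry j k)) \<le> 2 ^ \<beta> j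
      \<and> norm (fst (entry j k)) \<le> 2 ^ \<beta> j * norm (snd (entry j k))
      \<and> norm (snd (entry j k)) \<le> 2 ^ \<beta> j * norm (fst (entry j k))" for j k
  proof (cases "1 \<le> k \<and> k \<le> K j")
    case True
    then show ?thesis
      using bound[OF pat_L[of j]] entry_set[of k j]
      by (fastforce simp: fits_def \<beta>_def split_beta)
  qed (auto simp: entry_def)
  have "pattern_sequence (\<lambda>j k. fst (entry j k)) (\<lambda>j k. snd (entry j k)) K \<beta>"
  proof
    fix j k
    show "K j \<le> j" "2 * \<beta> j * K j \<le> j"
      using pat_affordable[of j] by (auto simp: affordable_def K_def \<beta>_def)
    have le: "(2::real) ^ \<beta> j \<le> 2 ^ j"
      using pat_affordable[of j] by (intro power_increasing) (auto simp: affordable_def \<beta>_def)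
    show "norm (fst (entry j k)) \<le> 2 ^ j" "norm (snd (entry j k)) \<le> 2 ^ j"
      using entry_fits[of j k] le by linarith+
    show "norm (fst (entry j k)) \<le> 2 ^ \<beta> j * norm (snd (entry j k))"
      "norm (snd (entry j k)) \<le> 2 ^ \<beta> j * norm (fst (entry j k))"
      using entry_fits[of j k] by auto
    show "\<not> (1 \<le> k \<and> k \<le> K j) \<Longrightarrow> fst (entry j k) = 0 \<and> snd (entry j k) = 0"
      by (simp only: entry_def if_False fst_conv snd_conv simp_thms)
    assume k: "1 \<le> k" "k \<le> K j"
    have "entry j k \<in> (D - {0}) \<times> (D - {0})"
      using entry_set[OF k] pat_L[of j] unfolding L_def by (rule in_listsD[rule_format, rotated])
    then show "fst (entry j k) \<noteq> 0 \<and> snd (entry j k) \<noteq> 0" by auto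
  next
    fix d :: real and N n and y z :: "nat \<Rightarrow> 'a" assume d: "d > 0"
    have ex: "\<exists>u\<in>D - {0}. norm (u - t) \<le> d" for t
    proof -
      (* Since the field has no isolated points, the dense set remains dense without 0. *)
      have "\<exists>u. u \<noteq> t \<and> dist u t < d"
        using d by (metis perfect_choose_dist)
      then have "\<exists>u. u \<in> ball t d - {0}"
        using d by (metis DiffI centre_in_ball dist_commute mem_ball singletonD)
      moreover have "open (ball t d - {0})" by (intro open_Diff) auto
      ultimately obtain u where "u \<in> D" "u \<in> ball t d - {0}" using D(2) by blast
      then show ?thesis by (auto simp: dist_norm norm_minus_commute intro!: bexI[of _ u])
    qed
    then obtain r where r: "\<And>t. r t \<in> D - {0}" "\<And>t. norm (r t - t) \<le> d" by metis
    define s where "s = map (\<lambda>k. (r (y k), r (z k))) [1..<Suc n]"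
    have s: "s \<in> L" using r(1) by (auto simp: s_def L_def)
    obtain i where i: "from_nat_into L i = s"
      using from_nat_into_surj[OF L(1) s] by blast
    (* The second component of the code can be as large as we please: this pays for s. *)
    define j where "j = prod_encode (i, N + length s + bound s + 2 * bound s * length s)"
    have j: "N + length s + bound s + 2 * bound s * length s \<le> j"
      unfolding j_def by (rule le_prod_encode_2)
    then have "affordable s j" by (simp add: affordable_def)
    then have pat: "pat j = s" by (simp add: pat_def j_def i)
    have "K j = n" by (simp add: K_def pat s_def)
    moreover have "entry j k = (r (y k), r (z k))" if "k \<in> {1..n}" for k
      using that \<open>K j = n\<close> by (auto simp: entry_def pat s_def nth_append simp del: upt_Suc)
    ultimately show "\<exists>j\<ge>N. K j = n \<and>
        (\<forall>k\<in>{1..n}. norm (fst (entry j k) - y k) \<le> d \<and> norm (snd (entry j k) - z k) \<le> d)"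
      using j r(2) by (intro exI[of _ j]) auto
  qed
  then show thesis by (rule that)
qed

lemma ex_weighted_shifts:
  assumes "1 \<le> p"
  shows "\<exists>v w :: nat \<Rightarrow> 'a::{real_normed_field, second_countable_topology}.
      bounded_weights v \<and> bounded_weights w
    \<and> frequently_hypercyclic (lp_topology p) (weighted_shift v)
    \<and> frequently_hypercyclic (lp_topology p) (weighted_shift w)
    \<and> disjoint_upper_frequently_hypercyclic (lp_topology p) (weighted_shift v) (weighted_shift w)
    \<and> \<not> disjoint_frequently_hypercyclic (lp_topology p) (weighted_shift v) (weighted_shift w)"
proof -
  obtain a b :: "nat \<Rightarrow> nat \<Rightarrow> 'a" and K \<beta> where "pattern_sequence a b K \<beta>"
    by (rule ex_pattern_sequence)
  then interpret pattern_sequence a b K \<beta> .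
  show ?thesis
    using bounded_ratio_weights[OF norm_V_bounds] bounded_ratio_weights[OF norm_W_bounds]
      frequently_hypercyclic_V[OF assms] frequently_hypercyclic_W[OF assms]
      disjoint_upper_frequently_hypercyclic_V_W[OF assms]
      not_disjoint_frequently_hypercyclic_V_W[OF assms]
    by blast
qed

theorem theorem4p2:
  fixes p :: real
  assumes "1 \<le> p"
  shows "(\<exists>v w :: nat \<Rightarrow> real.
            bounded_weights v \<and> bounded_weights w
          \<and> frequently_hypercyclic (lp_topology p) (weighted_shift v)
          \<and> frequently_hypercyclic (lp_topology p) (weighted_shift w)
          \<and> disjoint_upper_frequently_hypercyclic (lp_topology p) (weighted_shift v) (weighted_shift w)
          \<and> \<not> disjoint_frequently_hypercyclic (lp_topology p) (weighted_shift v) (weighted_shift w))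
       \<and> (\<exists>v w :: nat \<Rightarrow> complex.
            bounded_weights v \<and> bounded_weights w
          \<and> frequently_hypercyclic (lp_topology p) (weighted_shift v)
          \<and> frequently_hypercyclic (lp_topology p) (weighted_shift w)
          \<and> disjoint_upper_frequently_hypercyclic (lp_topology p) (weighted_shift v) (weighted_shift w)
          \<and> \<not> disjoint_frequently_hypercyclic (lp_topology p) (weighted_shift v) (weighted_shift w))"
  using ex_weighted_shifts[OF assms] ex_weighted_shifts[OF assms] by (rule conjI)

end
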